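(* Let $G$ be a finite group, $r:= r(G)$, and $A$ a finite set of size $q \geq 2$. Let $r_i$ be the number of conjugacy classes of subgroups of $G$ of index $i$. Let $p_1, \dots, p_s$ be the (distinct) prime divisors of $|G|$ and let $r_P = \sum_{i=1}^s r_{p_i}$. Then \[ \mathrm{Rank}( \mathrm{ICA}( G; A )) \leq \begin{cases} (r-r_P -1)\, \ell(G) + 2r - r_2 -1 & \text{if } q=2, \\ (r - r_P - 1)\, \ell(G) + 2r & \text{if } q\geq 3. \end{cases} \]
   Context: For a finite group $G$, $r(G)$ is the total number of conjugacy classes of subgroups of $G$. The length $\ell(G)$ is the largest $\ell$ for which there is a chain of subgroups $1=G_0 < G_1 < \dots < G_\ell = G$ with strict inclusions. For a group $G$ and a finite set $A$, $A^G$ is the set of all functions $x : G \to A$, with the shift action $(g\cdot x)(h) = x(g^{-1}h)$. A cellular automaton over $A^G$ is a map $\tau : A^G \to A^G$ for which there exist a finite subset $S \subseteq G$ and a function $\mu : A^S \to A$ such that $\tau(x)(g) = \mu((g^{-1}\cdot x)|_S)$ for all $x \in A^G$, $g\in G$. $\mathrm{CA}(G;A)$ is the monoid of all cellular automata over $A^G$ under composition, and $\mathrm{ICA}(G;A)$ is its group of units. For a monoid $M$, $\mathrm{Rank}(M)$ is the minimal cardinality of a subset $T \subseteq M$ generating $M$ as a monoid. *)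

theory Defs
  imports "HOL-Algebra.Group_Action" "HOL-Computational_Algebra.Primes"
begin

section \<open>Conjugacy classes and chains of subgroups\<close>

definition subgroup_classes :: "('a, 'm) monoid_scheme \<Rightarrow> 'a set set set" where
  "subgroup_classes G =
     orbits G {H. subgroup H G}
       (\<lambda>g. \<lambda>H\<in>{H. subgroup H G}. g <#\<^bsub>G\<^esub> H #>\<^bsub>G\<^esub> inv\<^bsub>G\<^esub> g)"

text \<open>Classes are nonempty and conjugate subgroups have equal index, so a class is counted
  below for exactly one \<open>i\<close> when the group is finite.\<close>

definition num_subgroup_classes :: "('a, 'm) monoid_scheme \<Rightarrow> nat" where
  "num_subgroup_classes G = card (subgroup_classes G)"

definition num_subgroup_classes_index :: "('a, 'm) monoid_scheme \<Rightarrow> nat \<Rightarrow> nat" where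
  "num_subgroup_classes_index G i =
     card {C \<in> subgroup_classes G. \<forall>H\<in>C. card (rcosets\<^bsub>G\<^esub> H) = i}"

definition is_subgroup_chain :: "('a, 'm) monoid_scheme \<Rightarrow> nat \<Rightarrow> (nat \<Rightarrow> 'a set) \<Rightarrow> bool" where
  "is_subgroup_chain G l H \<longleftrightarrow>
     H 0 = {\<one>\<^bsub>G\<^esub>} \<and> H l = carrier G \<and>
     (\<forall>i\<le>l. subgroup (H i) G) \<and> (\<forall>i<l. H i \<subset> H (Suc i))"

text \<open>Meaningful for finite groups, where chain lengths are bounded.\<close>

definition subgroup_length :: "('a, 'm) monoid_scheme \<Rightarrow> nat" where
  "subgroup_length G = (GREATEST l. \<exists>H. is_subgroup_chain G l H)"

section \<open>Cellular automata\<close>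

text \<open>Configurations, and maps between them, are extensional functions, so that equality
  of functions on the intended domains is equality in HOL.\<close>

definition configs :: "('a, 'm) monoid_scheme \<Rightarrow> 'b set \<Rightarrow> ('a \<Rightarrow> 'b) set" where
  "configs G A = carrier G \<rightarrow>\<^sub>E A"

definition shift_config :: "('a, 'm) monoid_scheme \<Rightarrow> 'a \<Rightarrow> ('a \<Rightarrow> 'b) \<Rightarrow> 'a \<Rightarrow> 'b" where
  "shift_config G g x = (\<lambda>h\<in>carrier G. x (inv\<^bsub>G\<^esub> g \<otimes>\<^bsub>G\<^esub> h))"

definition cellular_automaton ::
    "('a, 'm) monoid_scheme \<Rightarrow> 'b set \<Rightarrow> (('a \<Rightarrow> 'b) \<Rightarrow> ('a \<Rightarrow> 'b)) \<Rightarrow> bool" where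
  "cellular_automaton G A \<tau> \<longleftrightarrow>
     \<tau> \<in> configs G A \<rightarrow>\<^sub>E configs G A \<and>
     (\<exists>S \<mu>. finite S \<and> S \<subseteq> carrier G \<and> \<mu> \<in> (S \<rightarrow>\<^sub>E A) \<rightarrow> A \<and>
        (\<forall>x\<in>configs G A. \<forall>g\<in>carrier G.
           \<tau> x g = \<mu> (restrict (shift_config G (inv\<^bsub>G\<^esub> g) x) S)))"

definition CA :: "('a, 'm) monoid_scheme \<Rightarrow> 'b set \<Rightarrow> (('a \<Rightarrow> 'b) \<Rightarrow> ('a \<Rightarrow> 'b)) monoid" where
  "CA G A =
     \<lparr>carrier = {\<tau>. cellular_automaton G A \<tau>},
      monoid.mult = compose (configs G A),
      one = (\<lambda>x\<in>configs G A. x)\<rparr>"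

definition ICA :: "('a, 'm) monoid_scheme \<Rightarrow> 'b set \<Rightarrow> (('a \<Rightarrow> 'b) \<Rightarrow> ('a \<Rightarrow> 'b)) monoid" where
  "ICA G A = units_of (CA G A)"

section \<open>Rank of a monoid\<close>

definition generated_submonoid :: "('a, 'm) monoid_scheme \<Rightarrow> 'a set \<Rightarrow> 'a set" where
  "generated_submonoid M T = \<Inter>{N. submonoid N M \<and> T \<subseteq> N}"

text \<open>Meaningful for finitely generated monoids, in particular for finite ones.\<close>

definition monoid_rank :: "('a, 'm) monoid_scheme \<Rightarrow> nat" where
  "monoid_rank M =
     (LEAST n. \<exists>T. T \<subseteq> carrier M \<and> finite T \<and> card T = n \<and>
        generated_submonoid M T = carrier M)"

end

(* The automorphism group of the finite G-set X = A^G is ICA(G;A). For points x, y with the same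
   stabilizer let s(x,y) exchange the orbits of x and y via g x <-> g y (or, if y lies in the orbit
   of x, map g x to g y there). These maps generate the automorphism group, since left
   multiplication by the inverse of s(x, f x) makes f fix strictly more points; moreover
   f s(x,y) f^-1 = s(f x, f y).

   So every class of subgroups can be treated separately. Fix H in the class, orbit representatives
   y_0, ..., y_(k-1) of the points with stabilizer H, and generators n_1, ..., n_d of N(H) over H.
   For k >= 2 the swap s(y_0,y_1), the cycle y_0 -> y_1 -> ... -> y_(k-1) -> n_1 y_0 and the maps
   s(y_0, n_j y_0) with j >= 2 suffice: conjugating the swap by powers of the cycle gives all
   s(y_i, y_(i+1)), hence the cycle without n_1, hence s(y_0, n_1 y_0). Thus max(d,1) + 1 generators
   are enough, and d are enough for k <= 1. Finally d is at most the length of G, d <= 1 if H has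
   prime index, and d = 0 if H = G. If q = 2, then k <= 1 for index 2 and k <= 2 for H = G, which
   saves one more generator in each case. *)

theory Submission
  imports Defs "HOL-Algebra.Generated_Groups"
begin

section \<open>Automorphisms of finite group actions\<close>

locale finite_action = G?: group G + group_action G E \<phi>
  for G (structure) and E and \<phi> +
  assumes finite_E: "finite E"
begin

text \<open>\<open>Bij E\<close> also demands extensionality, as in the encoding of cellular
  automata, so equal values on \<open>E\<close> give equal functions.\<close>

definition automorphisms :: "('c \<Rightarrow> 'c) set" where
  "automorphisms = {f \<in> Bij E. \<forall>g\<in>carrier G. \<forall>x\<in>E. f (\<phi> g x) = \<phi> g (f x)}"

text \<open>Independent of the chosen \<open>g\<close> once \<open>x\<close> and \<open>y\<close>
  have the same stabilizer. The order of the branches matters: if \<open>y\<close> lies in the orbit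
  of \<open>x\<close>, only the first can move points, and the map need not be an
  involution.\<close>

definition orbit_swap :: "'c \<Rightarrow> 'c \<Rightarrow> 'c \<Rightarrow> 'c" where
  "orbit_swap x y = (\<lambda>z\<in>E.
     if z \<in> orbit G \<phi> x then \<phi> (SOME g. g \<in> carrier G \<and> \<phi> g x = z) y
     else if z \<in> orbit G \<phi> y then \<phi> (SOME g. g \<in> carrier G \<and> \<phi> g y = z) x
     else z)"

section \<open>The action on points, orbits and stabilizers\<close>

lemma act_closed [simp]: "g \<in> carrier G \<Longrightarrow> x \<in> E \<Longrightarrow> \<phi> g x \<in> E"
  using element_image by blast

lemma act_mult [simp]:
  "x \<in> E \<Longrightarrow> g \<in> carrier G \<Longrightarrow> h \<in> carrier G \<Longrightarrow> \<phi> (g \<otimes> h) x = \<phi> g (\<phi> h x)"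
  by (rule composition_rule)

lemma act_one [simp]: "x \<in> E \<Longrightarrow> \<phi> \<one> x = x"
  by (metis id_eq_one restrict_apply')

lemma act_inv_cancel [simp]:
  "g \<in> carrier G \<Longrightarrow> x \<in> E \<Longrightarrow> \<phi> (inv g) (\<phi> g x) = x"
  "g \<in> carrier G \<Longrightarrow> x \<in> E \<Longrightarrow> \<phi> g (\<phi> (inv g) x) = x"
  using orbit_sym_aux by (blast, metis act_mult act_one inv_closed r_inv)

lemma act_inj [simp]:
  "g \<in> carrier G \<Longrightarrow> x \<in> E \<Longrightarrow> y \<in> E \<Longrightarrow> \<phi> g x = \<phi> g y \<longleftrightarrow> x = y"
  by (metis act_inv_cancel(1))

lemma in_orbit_iff: "z \<in> orbit G \<phi> x \<longleftrightarrow> (\<exists>g\<in>carrier G. z = \<phi> g x)"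
  by (auto simp: orbit_def)

lemma act_in_orbit_iff [simp]:
  assumes "g \<in> carrier G" "x \<in> E" "y \<in> E"
  shows "\<phi> g x \<in> orbit G \<phi> y \<longleftrightarrow> x \<in> orbit G \<phi> y"
proof
  assume "\<phi> g x \<in> orbit G \<phi> y"
  then obtain h where "h \<in> carrier G" "\<phi> g x = \<phi> h y" by (auto simp: in_orbit_iff)
  then have "x = \<phi> (inv g \<otimes> h) y" using assms by (metis act_inv_cancel(1) act_mult inv_closed)
  then show "x \<in> orbit G \<phi> y"
    using assms \<open>h \<in> carrier G\<close> by (metis in_orbit_iff inv_closed m_closed)
next
  assume "x \<in> orbit G \<phi> y"
  then obtain h where "h \<in> carrier G" "x = \<phi> h y" by (auto simp: in_orbit_iff)
  then have "\<phi> g x = \<phi> (g \<otimes> h) y" using assms by simp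
  then show "\<phi> g x \<in> orbit G \<phi> y"
    using assms \<open>h \<in> carrier G\<close> by (metis in_orbit_iff m_closed)
qed

lemma in_orbit_sym: "x \<in> E \<Longrightarrow> y \<in> E \<Longrightarrow> x \<in> orbit G \<phi> y \<longleftrightarrow> y \<in> orbit G \<phi> x"
  using orbit_sym by blast

lemma orbit_act [simp]:
  assumes "g \<in> carrier G" "x \<in> E"
  shows "orbit G \<phi> (\<phi> g x) = orbit G \<phi> x"
proof -
  have sub: "orbit G \<phi> z \<subseteq> E" if "z \<in> E" for z
    using that by (auto simp: orbit_def)
  have iff: "y \<in> orbit G \<phi> (\<phi> g x) \<longleftrightarrow> y \<in> orbit G \<phi> x" if "y \<in> E" for y
    using assms in_orbit_sym[OF that, of x] in_orbit_sym[OF that, of "\<phi> g x"] that by simp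
  show ?thesis
  proof (rule Set.set_eqI)
    fix y
    show "y \<in> orbit G \<phi> (\<phi> g x) \<longleftrightarrow> y \<in> orbit G \<phi> x"
      using sub[OF assms(2)] sub[OF act_closed[OF assms]] iff[of y] by blast
  qed
qed

lemma act_eq_act_iff:
  assumes "g \<in> carrier G" "h \<in> carrier G" "x \<in> E"
  shows "\<phi> g x = \<phi> h x \<longleftrightarrow> inv h \<otimes> g \<in> stabilizer G \<phi> x"
proof -
  have "inv h \<otimes> g \<in> stabilizer G \<phi> x \<longleftrightarrow> \<phi> (inv h) (\<phi> g x) = \<phi> (inv h) (\<phi> h x)"
    using assms by (simp add: stabilizer_def)
  then show ?thesis using assms by (simp del: act_inv_cancel)
qed

lemma stabilizer_act:
  assumes "g \<in> carrier G" "x \<in> E"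
  shows "stabilizer G \<phi> (\<phi> g x) = g <# stabilizer G \<phi> x #> inv g"
proof (intro equalityI subsetI)
  fix h assume "h \<in> stabilizer G \<phi> (\<phi> g x)"
  then have h: "h \<in> carrier G" "\<phi> h (\<phi> g x) = \<phi> g x" by (auto simp: stabilizer_def)
  then have "inv g \<otimes> h \<otimes> g \<in> stabilizer G \<phi> x"
    using assms by (simp add: stabilizer_def)
  moreover have "h = g \<otimes> (inv g \<otimes> h \<otimes> g) \<otimes> inv g"
    using assms h by (simp add: conjugation_is_surj)
  ultimately show "h \<in> g <# stabilizer G \<phi> x #> inv g"
    unfolding l_coset_def r_coset_def by blast
next
  fix h assume "h \<in> g <# stabilizer G \<phi> x #> inv g"
  then obtain k where "k \<in> stabilizer G \<phi> x" "h = g \<otimes> k \<otimes> inv g"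
    unfolding l_coset_def r_coset_def by blast
  then show "h \<in> stabilizer G \<phi> (\<phi> g x)"
    using assms by (simp add: stabilizer_def)
qed

section \<open>Orbit swaps are well defined, equivariant and bijective\<close>

lemma act_SOME_eq:
  assumes "x \<in> E" "y \<in> E" "stabilizer G \<phi> x = stabilizer G \<phi> y" "g \<in> carrier G"
  shows "\<phi> (SOME k. k \<in> carrier G \<and> \<phi> k x = \<phi> g x) y = \<phi> g y"
proof -
  define k where "k = (SOME k. k \<in> carrier G \<and> \<phi> k x = \<phi> g x)"
  have k: "k \<in> carrier G \<and> \<phi> k x = \<phi> g x"
    unfolding k_def by (rule someI[of _ g]) (use assms in simp)
  then have "inv g \<otimes> k \<in> stabilizer G \<phi> x"
    using act_eq_act_iff[of k g x] assms(1,4) by blast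
  then have "\<phi> k y = \<phi> g y"
    using act_eq_act_iff[of k g y] k assms by blast
  then show ?thesis by (simp only: k_def)
qed

lemma orbit_swap_left:
  assumes "x \<in> E" "y \<in> E" "stabilizer G \<phi> x = stabilizer G \<phi> y" "g \<in> carrier G"
  shows "orbit_swap x y (\<phi> g x) = \<phi> g y"
  using assms(1,2,4) orbit_refl[of x] by (simp add: orbit_swap_def act_SOME_eq[OF assms])

lemma orbit_swap_right:
  assumes "x \<in> E" "y \<in> E" "stabilizer G \<phi> x = stabilizer G \<phi> y" "g \<in> carrier G"
    "y \<notin> orbit G \<phi> x"
  shows "orbit_swap x y (\<phi> g y) = \<phi> g x"
  using assms(1,2,4,5) orbit_refl[of y]
  by (simp add: orbit_swap_def act_SOME_eq[OF assms(2,1) assms(3)[symmetric] assms(4)])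

lemma orbit_swap_other:
  "z \<in> E \<Longrightarrow> z \<notin> orbit G \<phi> x \<Longrightarrow> z \<notin> orbit G \<phi> y \<Longrightarrow> orbit_swap x y z = z"
  by (simp add: orbit_swap_def)

lemma orbit_swap_left1:
  assumes "x \<in> E" "y \<in> E" "stabilizer G \<phi> x = stabilizer G \<phi> y"
  shows "orbit_swap x y x = y"
  using orbit_swap_left[OF assms, of \<one>] assms by simp

lemma orbit_swap_right1:
  assumes "x \<in> E" "y \<in> E" "stabilizer G \<phi> x = stabilizer G \<phi> y" "y \<notin> orbit G \<phi> x"
  shows "orbit_swap x y y = x"
  using orbit_swap_right[OF assms(1-3) _ assms(4), of \<one>] assms by simp

lemma orbit_swap_cases:
  obtains (left) g where "g \<in> carrier G" "z = \<phi> g x"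
  | (right) g where "g \<in> carrier G" "z = \<phi> g y" "z \<notin> orbit G \<phi> x"
  | (other) "z \<notin> orbit G \<phi> x" "z \<notin> orbit G \<phi> y"
  using in_orbit_iff by metis

lemma orbit_swap_act:
  assumes xy: "x \<in> E" "y \<in> E" "stabilizer G \<phi> x = stabilizer G \<phi> y"
    and "h \<in> carrier G" "z \<in> E"
  shows "orbit_swap x y (\<phi> h z) = \<phi> h (orbit_swap x y z)"
proof (cases rule: orbit_swap_cases[where z=z and x=x and y=y])
  case (left g)
  then show ?thesis
    using orbit_swap_left[OF xy, of g] orbit_swap_left[OF xy, of "h \<otimes> g"] assms by simp
next
  case (right g)
  then have "y \<notin> orbit G \<phi> x" using assms by simp
  with right show ?thesis
    using orbit_swap_right[OF xy, of g] orbit_swap_right[OF xy, of "h \<otimes> g"] assms by simp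
next
  case other
  then show ?thesis using assms by (simp add: orbit_swap_other)
qed

lemma orbit_swap_in_automorphisms:
  assumes xy: "x \<in> E" "y \<in> E" "stabilizer G \<phi> x = stabilizer G \<phi> y"
  shows "orbit_swap x y \<in> automorphisms"
proof -
  have sub: "E \<subseteq> orbit_swap x y ` E"
  proof
    fix z assume z: "z \<in> E"
    show "z \<in> orbit_swap x y ` E"
    \<comment> \<open>Preimages are sought, so \<open>x\<close> and \<open>y\<close> exchange roles:
      orbit points of \<open>y\<close> come from those of \<open>x\<close>, and any remaining orbit
      points of \<open>x\<close> from those of \<open>y\<close>.\<close>
    proof (cases rule: orbit_swap_cases[where z=z and x=y and y=x])
      case (left g)
      then show ?thesis using orbit_swap_left[OF xy, of g] xy by (metis act_closed image_eqI)
    next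
      case (right g)
      then have "y \<notin> orbit G \<phi> x" using xy in_orbit_sym[of x y] by simp
      with right show ?thesis
        using orbit_swap_right[OF xy, of g] xy by (metis act_closed image_eqI)
    next
      case other
      then show ?thesis using z orbit_swap_other by (metis image_eqI)
    qed
  qed
  have "orbit_swap x y ` E \<subseteq> E"
  proof safe
    fix z assume z: "z \<in> E"
    show "orbit_swap x y z \<in> E"
    proof (cases rule: orbit_swap_cases[where z=z and x=x and y=y])
      case (left g)
      then show ?thesis using orbit_swap_left[OF xy, of g] xy by simp
    next
      case (right g)
      then have "y \<notin> orbit G \<phi> x" using xy by simp
      with right show ?thesis using orbit_swap_right[OF xy, of g] xy by simp
    next
      case other
      then show ?thesis using z by (simp add: orbit_swap_other)
    qed
  qed
  with sub have img: "orbit_swap x y ` E = E" by blast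
  then have "inj_on (orbit_swap x y) E" using finite_E by (simp add: eq_card_imp_inj_on)
  then have "orbit_swap x y \<in> Bij E"
    using img by (auto simp: Bij_def bij_betw_def orbit_swap_def)
  then show ?thesis using orbit_swap_act[OF xy] by (simp add: automorphisms_def)
qed

text \<open>Moving both points by the same \<open>g\<close> merely reindexes the pairing of the two
  orbits. This later replaces arbitrary pairs by chosen representatives.\<close>

lemma orbit_swap_shift:
  assumes xy: "x \<in> E" "y \<in> E" "stabilizer G \<phi> x = stabilizer G \<phi> y" and g: "g \<in> carrier G"
  shows "orbit_swap (\<phi> g x) (\<phi> g y) = orbit_swap x y"
proof (rule extensionalityI[of _ E])
  fix z assume z: "z \<in> E"
  have xy': "\<phi> g x \<in> E" "\<phi> g y \<in> E" "stabilizer G \<phi> (\<phi> g x) = stabilizer G \<phi> (\<phi> g y)"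
    using xy g by (simp_all add: stabilizer_act)
  show "orbit_swap (\<phi> g x) (\<phi> g y) z = orbit_swap x y z"
  proof (cases rule: orbit_swap_cases[where z=z and x="\<phi> g x" and y="\<phi> g y"])
    case (left h)
    then show ?thesis
      using orbit_swap_left[OF xy', of h] orbit_swap_left[OF xy, of "h \<otimes> g"] xy g by simp
  next
    case (right h)
    then have "\<phi> g y \<notin> orbit G \<phi> (\<phi> g x)" "y \<notin> orbit G \<phi> x"
      using xy g by simp_all
    with right show ?thesis
      using orbit_swap_right[OF xy', of h] orbit_swap_right[OF xy, of "h \<otimes> g"] xy g by simp
  next
    case other
    then have "z \<notin> orbit G \<phi> x" "z \<notin> orbit G \<phi> y"
      using xy g by simp_all
    then show ?thesis using z other by (simp add: orbit_swap_other)
  qed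
qed (auto simp: orbit_swap_def)

section \<open>Equivariant permutations and their effect on stabilizers, orbits and swaps\<close>

lemma automorphism_closed [simp]: "f \<in> automorphisms \<Longrightarrow> x \<in> E \<Longrightarrow> f x \<in> E"
  using Bij_imp_funcset by (auto simp: automorphisms_def)

lemma automorphism_inj: "f \<in> automorphisms \<Longrightarrow> x \<in> E \<Longrightarrow> y \<in> E \<Longrightarrow> f x = f y \<longleftrightarrow> x = y"
  using inj_on_eq_iff[of f E] by (simp add: automorphisms_def Bij_def bij_betw_def)

lemma automorphism_act [simp]:
  "f \<in> automorphisms \<Longrightarrow> g \<in> carrier G \<Longrightarrow> x \<in> E \<Longrightarrow> f (\<phi> g x) = \<phi> g (f x)"
  by (simp add: automorphisms_def)

lemma automorphism_extensional: "f \<in> automorphisms \<Longrightarrow> f \<in> extensional E"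
  by (simp add: automorphisms_def Bij_def)

lemma automorphism_stabilizer:
  assumes "f \<in> automorphisms" "x \<in> E"
  shows "stabilizer G \<phi> (f x) = stabilizer G \<phi> x"
proof -
  have "\<phi> g (f x) = f x \<longleftrightarrow> \<phi> g x = x" if "g \<in> carrier G" for g
    using assms that automorphism_inj[of f "\<phi> g x" x] by simp
  then show ?thesis by (auto simp: stabilizer_def)
qed

lemma automorphism_orbit:
  assumes "f \<in> automorphisms" "x \<in> E" "y \<in> E"
  shows "f y \<in> orbit G \<phi> (f x) \<longleftrightarrow> y \<in> orbit G \<phi> x"
proof -
  have "f y = \<phi> g (f x) \<longleftrightarrow> y = \<phi> g x" if "g \<in> carrier G" for g
    using assms that automorphism_inj[of f y "\<phi> g x"] by simp
  then show ?thesis by (auto simp: in_orbit_iff)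
qed

lemma compose_in_automorphisms:
  "f \<in> automorphisms \<Longrightarrow> h \<in> automorphisms \<Longrightarrow> compose E f h \<in> automorphisms"
proof -
  assume f: "f \<in> automorphisms" and h: "h \<in> automorphisms"
  then have "compose E f h \<in> Bij E" by (simp add: automorphisms_def compose_Bij)
  with f h show ?thesis by (subst automorphisms_def) (simp add: compose_eq)
qed

lemma automorphism_conj_orbit_swap:
  assumes f: "f \<in> automorphisms"
    and xy: "x \<in> E" "y \<in> E" "stabilizer G \<phi> x = stabilizer G \<phi> y" and z: "z \<in> E"
  shows "f (orbit_swap x y z) = orbit_swap (f x) (f y) (f z)"
proof -
  have xy': "f x \<in> E" "f y \<in> E" "stabilizer G \<phi> (f x) = stabilizer G \<phi> (f y)"
    using xy f by (simp_all add: automorphism_stabilizer)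
  show ?thesis
  proof (cases rule: orbit_swap_cases[where z=z and x=x and y=y])
    case (left h)
    then show ?thesis
      using orbit_swap_left[OF xy', of h] orbit_swap_left[OF xy, of h] f xy by simp
  next
    case (right h)
    then have "f y \<notin> orbit G \<phi> (f x)" "y \<notin> orbit G \<phi> x"
      using xy f by (simp_all add: automorphism_orbit)
    with right show ?thesis
      using orbit_swap_right[OF xy', of h] orbit_swap_right[OF xy, of h] f xy by simp
  next
    case other
    then show ?thesis using z xy f by (simp add: orbit_swap_other automorphism_orbit)
  qed
qed

lemma id_in_automorphisms: "(\<lambda>x\<in>E. x) \<in> automorphisms"
  by (simp add: automorphisms_def id_Bij)

text \<open>By equivariance the value at \<open>x\<close> determines \<open>f\<close> on the whole
  orbit. This recognises composed or inverted maps as swaps inside one orbit.\<close>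

lemma automorphism_eq_orbit_swap:
  assumes f: "f \<in> automorphisms" and x: "x \<in> E" and "f x \<in> orbit G \<phi> x"
    and fix_f: "\<And>z. z \<in> E \<Longrightarrow> z \<notin> orbit G \<phi> x \<Longrightarrow> f z = z"
  shows "f = orbit_swap x (f x)"
proof (rule extensionalityI[of _ E])
  fix z assume z: "z \<in> E"
  have st: "x \<in> E" "f x \<in> E" "stabilizer G \<phi> x = stabilizer G \<phi> (f x)"
    using x f automorphism_stabilizer by auto
  show "f z = orbit_swap x (f x) z"
  proof (cases "z \<in> orbit G \<phi> x")
    case True
    then obtain g where "g \<in> carrier G" "z = \<phi> g x" by (auto simp: orbit_def)
    then show ?thesis using orbit_swap_left[OF st, of g] f x by simp
  next
    case False
    obtain g where g: "g \<in> carrier G" "f x = \<phi> g x"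
      using assms(3) unfolding in_orbit_iff by blast
    then have "orbit G \<phi> (f x) = orbit G \<phi> x" using x by simp
    with False show ?thesis using fix_f[OF z] orbit_swap_other[OF z] by simp
  qed
qed (use f automorphism_extensional in \<open>auto simp: orbit_swap_def\<close>)

section \<open>Orbit representatives for a fixed stabilizer, and the cycle through them\<close>

definition transversal :: "'a set \<Rightarrow> nat \<Rightarrow> (nat \<Rightarrow> 'c) \<Rightarrow> bool" where
  "transversal H k y \<longleftrightarrow>
     (\<forall>i<k. y i \<in> E \<and> stabilizer G \<phi> (y i) = H) \<and>
     (\<forall>i<k. \<forall>j<k. i \<noteq> j \<longrightarrow> y j \<notin> orbit G \<phi> (y i)) \<and>
     (\<forall>x\<in>E. stabilizer G \<phi> x = H \<longrightarrow> (\<exists>i<k. x \<in> orbit G \<phi> (y i)))"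

lemma transversalD:
  assumes "transversal H k y"
  shows "i < k \<Longrightarrow> y i \<in> E" "i < k \<Longrightarrow> stabilizer G \<phi> (y i) = H"
    "i < k \<Longrightarrow> j < k \<Longrightarrow> i \<noteq> j \<Longrightarrow> y j \<notin> orbit G \<phi> (y i)"
  using assms by (auto simp: transversal_def)

lemma transversal_exists:
  obtains y where "transversal H (card (orbit G \<phi> ` {x \<in> E. stabilizer G \<phi> x = H})) y"
proof -
  let ?Y = "{x \<in> E. stabilizer G \<phi> x = H}"
  obtain e where e: "bij_betw e {0..<card (orbit G \<phi> ` ?Y)} (orbit G \<phi> ` ?Y)"
    using ex_bij_betw_nat_finite[of "orbit G \<phi> ` ?Y"] finite_E by auto
  define y where "y i = (SOME x. x \<in> ?Y \<and> orbit G \<phi> x = e i)" for i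
  have y: "y i \<in> ?Y \<and> orbit G \<phi> (y i) = e i" if "i < card (orbit G \<phi> ` ?Y)" for i
  proof -
    have "e i \<in> orbit G \<phi> ` ?Y" using bij_betwE[OF e] that by simp
    then have "\<exists>x. x \<in> ?Y \<and> orbit G \<phi> x = e i" by blast
    then show ?thesis unfolding y_def by (rule someI_ex)
  qed
  have "transversal H (card (orbit G \<phi> ` ?Y)) y"
    unfolding transversal_def
  proof (intro conjI allI impI ballI)
    fix i j assume ij: "i < card (orbit G \<phi> ` ?Y)" "j < card (orbit G \<phi> ` ?Y)" "i \<noteq> j"
    show "y j \<notin> orbit G \<phi> (y i)"
    proof
      assume "y j \<in> orbit G \<phi> (y i)"
      then obtain g where "g \<in> carrier G" "y j = \<phi> g (y i)" by (auto simp: orbit_def)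
      then have "orbit G \<phi> (y j) = orbit G \<phi> (y i)" using y[OF ij(1)] by simp
      then have "e j = e i" using y ij by metis
      then show False using inj_onD[OF bij_betw_imp_inj_on[OF e], of j i] ij by simp
    qed
  next
    fix x assume x: "x \<in> E" "stabilizer G \<phi> x = H"
    then have "orbit G \<phi> x \<in> orbit G \<phi> ` ?Y" by blast
    then have "orbit G \<phi> x \<in> e ` {0..<card (orbit G \<phi> ` ?Y)}"
      using bij_betw_imp_surj_on[OF e] by simp
    then obtain i where i: "i < card (orbit G \<phi> ` ?Y)" "orbit G \<phi> x = e i" by auto
    then show "\<exists>i<card (orbit G \<phi> ` ?Y). x \<in> orbit G \<phi> (y i)"
      using y[OF i(1)] orbit_refl[OF x(1)] by metis
  qed (use y in simp_all)
  then show thesis by (rule that)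
qed

text \<open>For a transversal \<open>y\<close> this maps \<open>y 0\<close> to \<open>y 1\<close>, ..., \<open>y (m - 1)\<close> to \<open>y m\<close>, and \<open>y m\<close> to \<open>y 0\<close>.\<close>

primrec orbit_cycle :: "(nat \<Rightarrow> 'c) \<Rightarrow> nat \<Rightarrow> 'c \<Rightarrow> 'c" where
  "orbit_cycle y 0 = (\<lambda>x\<in>E. x)"
| "orbit_cycle y (Suc m) = compose E (orbit_cycle y m) (orbit_swap (y m) (y (Suc m)))"

lemma orbit_cycle_in_automorphisms:
  assumes "transversal H k y" "m < k"
  shows "orbit_cycle y m \<in> automorphisms"
  using assms(2)
proof (induction m)
  case (Suc m)
  then show ?case using transversalD[OF assms(1)]
    by (simp add: compose_in_automorphisms orbit_swap_in_automorphisms)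
qed (simp add: id_in_automorphisms)

text \<open>The innermost swap acts first. It sends \<open>y m\<close> to \<open>y (Suc m)\<close>,
  which the shorter cycle fixes, and \<open>y (Suc m)\<close> to \<open>y m\<close>, which the
  shorter cycle sends to \<open>y 0\<close>.\<close>

lemma orbit_cycle_apply:
  assumes "transversal H k y" "m < k" "i < k"
  shows "orbit_cycle y m (y i) = (if i < m then y (Suc i) else if i = m then y 0 else y i)"
  using assms(2,3)
proof (induction m arbitrary: i)
  case 0
  then show ?case using transversalD[OF assms(1)] by simp
next
  case (Suc m)
  note y = transversalD[OF assms(1)]
  have m: "y m \<in> E" "y (Suc m) \<in> E" "stabilizer G \<phi> (y m) = stabilizer G \<phi> (y (Suc m))"
    "y (Suc m) \<notin> orbit G \<phi> (y m)"
    using y Suc.prems by simp_all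
  consider "i = m" | "i = Suc m" | "i \<noteq> m" "i \<noteq> Suc m" by blast
  then show ?case
  proof cases
    case 1
    then show ?thesis
      using Suc.IH[of "Suc m"] Suc.prems orbit_swap_left1[OF m(1-3)] m by (simp add: compose_eq)
  next
    case 2
    then show ?thesis
      using Suc.IH[of m] Suc.prems orbit_swap_right1[OF m] m by (simp add: compose_eq)
  next
    case 3
    then have "y i \<notin> orbit G \<phi> (y m)" "y i \<notin> orbit G \<phi> (y (Suc m))"
      using y Suc.prems by simp_all
    then have "orbit_swap (y m) (y (Suc m)) (y i) = y i"
      using y Suc.prems by (simp add: orbit_swap_other)
    then show ?thesis
      using Suc.IH[of i] Suc.prems y 3 by (simp add: compose_eq)
  qed
qed

end

section \<open>Submonoids of the automorphism group and the swaps they contain\<close>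

locale automorphism_submonoid = finite_action +
  fixes \<Gamma>
  assumes sub: "\<Gamma> \<subseteq> automorphisms"
    and id_closed: "(\<lambda>x\<in>E. x) \<in> \<Gamma>"
    and compose_closed: "f \<in> \<Gamma> \<Longrightarrow> h \<in> \<Gamma> \<Longrightarrow> compose E f h \<in> \<Gamma>"
begin

text \<open>Only monoid closure is assumed, because the rank counts monoid generators. Inverses come
  from finiteness: composing with \<open>f\<close> on the left is injective on the finite set
  \<open>\<Gamma>\<close>, hence reaches the identity.\<close>

lemma inverse_exists:
  assumes "f \<in> \<Gamma>"
  obtains h where "h \<in> \<Gamma>" "\<And>x. x \<in> E \<Longrightarrow> h (f x) = x" "\<And>x. x \<in> E \<Longrightarrow> f (h x) = x"
proof -
  have f: "f \<in> automorphisms" using assms sub by blast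
  have "finite (E \<rightarrow>\<^sub>E E)" using finite_E by (simp add: finite_PiE)
  moreover have "\<Gamma> \<subseteq> E \<rightarrow>\<^sub>E E"
  proof
    fix h assume "h \<in> \<Gamma>"
    then have "h \<in> automorphisms" using sub by blast
    then show "h \<in> E \<rightarrow>\<^sub>E E" using automorphism_extensional by (simp add: PiE_def)
  qed
  ultimately have "finite \<Gamma>" by (rule rev_finite_subset)
  moreover have "compose E f ` \<Gamma> \<subseteq> \<Gamma>" using assms compose_closed by blast
  moreover have "inj_on (compose E f) \<Gamma>"
  proof (rule inj_onI)
    fix h k assume hk: "h \<in> \<Gamma>" "k \<in> \<Gamma>" "compose E f h = compose E f k"
    then have aut: "h \<in> automorphisms" "k \<in> automorphisms" using sub by auto
    show "h = k"
    proof (rule extensionalityI[of _ E])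
      fix x assume x: "x \<in> E"
      have "f (h x) = f (k x)" using fun_cong[OF hk(3), of x] x by (simp add: compose_eq)
      then show "h x = k x" using automorphism_inj[OF f] aut x by simp
    qed (use aut automorphism_extensional in auto)
  qed
  ultimately have "compose E f ` \<Gamma> = \<Gamma>" by (rule endo_inj_surj)
  then have "(\<lambda>x\<in>E. x) \<in> compose E f ` \<Gamma>" using id_closed by simp
  then obtain h where h: "h \<in> \<Gamma>" "compose E f h = (\<lambda>x\<in>E. x)" by (metis imageE)
  have 1: "f (h x) = x" if "x \<in> E" for x
    using fun_cong[OF h(2), of x] that by (simp add: compose_eq)
  have aut: "h \<in> automorphisms" using h sub by blast
  have 2: "h (f x) = x" if "x \<in> E" for x
    using 1[of "f x"] automorphism_inj[OF f, of "h (f x)" x] that aut f by simp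
  show thesis using that[OF h(1) 2 1] .
qed

lemma conj_orbit_swap_closed:
  assumes "f \<in> \<Gamma>" "orbit_swap x y \<in> \<Gamma>"
    and xy: "x \<in> E" "y \<in> E" "stabilizer G \<phi> x = stabilizer G \<phi> y"
  shows "orbit_swap (f x) (f y) \<in> \<Gamma>"
proof -
  obtain h where h: "h \<in> \<Gamma>" "\<And>x. x \<in> E \<Longrightarrow> f (h x) = x"
    using inverse_exists[OF assms(1)] by metis
  have aut: "f \<in> automorphisms" "h \<in> automorphisms" using assms h sub by auto
  have "orbit_swap (f x) (f y) = compose E f (compose E (orbit_swap x y) h)"
  proof (rule extensionalityI[of _ E])
    fix z assume z: "z \<in> E"
    then show "orbit_swap (f x) (f y) z = compose E f (compose E (orbit_swap x y) h) z"
      using automorphism_conj_orbit_swap[OF aut(1) xy, of "h z"] h(2)[OF z] aut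
      by (simp add: compose_eq)
  qed (auto simp: orbit_swap_def compose_def)
  then show ?thesis using assms h compose_closed by simp
qed

text \<open>Induction on the number of moved points: undoing the swap of \<open>x\<close> with
  \<open>f x\<close> after \<open>f\<close> fixes \<open>x\<close> and keeps every fixed point of
  \<open>f\<close>.\<close>

lemma automorphisms_subset:
  assumes swaps: "\<And>x y. x \<in> E \<Longrightarrow> y \<in> E \<Longrightarrow> stabilizer G \<phi> x = stabilizer G \<phi> y \<Longrightarrow>
    orbit_swap x y \<in> \<Gamma>"
  shows "automorphisms \<subseteq> \<Gamma>"
proof
  fix f assume "f \<in> automorphisms"
  then show "f \<in> \<Gamma>"
  proof (induction "card {x \<in> E. f x \<noteq> x}" arbitrary: f rule: less_induct)
    case less
    note f = \<open>f \<in> automorphisms\<close>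
    show ?case
    proof (cases "\<forall>x\<in>E. f x = x")
      case True
      then have "f = (\<lambda>x\<in>E. x)"
        using automorphism_extensional[OF f] by (intro extensionalityI[of _ E]) auto
      then show ?thesis using id_closed by simp
    next
      case False
      then obtain x where x: "x \<in> E" "f x \<noteq> x" by blast
      let ?s = "orbit_swap x (f x)"
      have st: "x \<in> E" "f x \<in> E" "stabilizer G \<phi> x = stabilizer G \<phi> (f x)"
        using x f automorphism_stabilizer by auto
      have s: "?s \<in> \<Gamma>" using swaps st by blast
      obtain h where h: "h \<in> \<Gamma>" "\<And>x. x \<in> E \<Longrightarrow> h (?s x) = x" "\<And>x. x \<in> E \<Longrightarrow> ?s (h x) = x"
        using inverse_exists[OF s] by metis
      have haut: "h \<in> automorphisms" using h sub by blast
      \<comment> \<open>A fixed point of \<open>f\<close> lies in neither orbit: equivariance and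
        injectivity would otherwise force \<open>f x = x\<close>.\<close>
      have "h z = z" if z: "z \<in> E" "f z = z" for z
      proof -
        have "z \<notin> orbit G \<phi> x"
        proof
          assume "z \<in> orbit G \<phi> x"
          then obtain g where "g \<in> carrier G" "z = \<phi> g x" by (auto simp: orbit_def)
          then show False using z x f by simp
        qed
        moreover have "z \<notin> orbit G \<phi> (f x)"
        proof
          assume "z \<in> orbit G \<phi> (f x)"
          then obtain g where g: "g \<in> carrier G" "z = \<phi> g (f x)" by (auto simp: orbit_def)
          then have "f z = f (\<phi> g x)" using z f x by simp
          then have "z = \<phi> g x" using z x g automorphism_inj[OF f, of z "\<phi> g x"] by simp
          then show False using g x f by simp
        qed
        ultimately have "?s z = z" using z by (simp add: orbit_swap_other)
        then show ?thesis using h(2)[OF z(1)] by simp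
      qed
      then have "{z \<in> E. compose E h f z \<noteq> z} \<subseteq> {z \<in> E. f z \<noteq> z}"
        by (auto simp: compose_eq)
      moreover have "compose E h f x = x"
        using h(2)[OF x(1)] orbit_swap_left1[OF st] x by (simp add: compose_eq)
      ultimately have "{z \<in> E. compose E h f z \<noteq> z} \<subset> {z \<in> E. f z \<noteq> z}"
        using x by blast
      then have "card {z \<in> E. compose E h f z \<noteq> z} < card {z \<in> E. f z \<noteq> z}"
        using finite_E by (intro psubset_card_mono) auto
      then have hf: "compose E h f \<in> \<Gamma>"
        using less.hyps compose_in_automorphisms[OF haut f] by blast
      have "f = compose E ?s (compose E h f)"
      proof (rule extensionalityI[of _ E])
        fix z assume "z \<in> E"
        then show "f z = compose E ?s (compose E h f) z"
          using h(3)[of "f z"] f by (simp add: compose_eq)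
      qed (use f automorphism_extensional in \<open>auto simp: compose_def\<close>)
      then show ?thesis using compose_closed[OF s hf] by simp
    qed
  qed
qed

text \<open>Swaps inside the orbit of \<open>x\<close> compose like the elements \<open>n\<close>,
  in reverse order. Hence it will suffice to treat generators of the normalizer of the
  stabilizer.\<close>

lemma subgroup_orbit_swap:
  assumes x: "x \<in> E"
  shows "subgroup {n \<in> carrier G. stabilizer G \<phi> (\<phi> n x) = stabilizer G \<phi> x \<and>
    orbit_swap x (\<phi> n x) \<in> \<Gamma>} G" (is "subgroup ?K G")
proof -
  \<comment> \<open>An element of \<open>\<Gamma>\<close> that sends \<open>x\<close> to
    \<open>\<phi> n x\<close> and is the identity off the orbit must be the swap for
    \<open>n\<close>.\<close>
  have key: "n \<in> ?K" if "n \<in> carrier G" "f \<in> \<Gamma>" "f x = \<phi> n x"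
    "\<And>z. z \<in> E \<Longrightarrow> z \<notin> orbit G \<phi> x \<Longrightarrow> f z = z" for n f
  proof -
    have f: "f \<in> automorphisms" using that sub by blast
    have "f x \<in> orbit G \<phi> x" using that by (auto simp: orbit_def)
    then have "f = orbit_swap x (\<phi> n x)"
      using automorphism_eq_orbit_swap[OF f x _ that(4)] that(3) by simp
    then show ?thesis using that automorphism_stabilizer[OF f x] by auto
  qed
  have K: "orbit_swap x (\<phi> n x) \<in> \<Gamma>" "orbit_swap x (\<phi> n x) x = \<phi> n x"
    "\<And>z. z \<in> E \<Longrightarrow> z \<notin> orbit G \<phi> x \<Longrightarrow> orbit_swap x (\<phi> n x) z = z" if "n \<in> ?K" for n
    using that x by (auto simp: orbit_swap_left1 intro: orbit_swap_other)
  show ?thesis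
  proof (rule subgroup.intro)
    show "?K \<subseteq> carrier G" by blast
    show "\<one> \<in> ?K" using key[of \<one> "\<lambda>x\<in>E. x"] x id_closed by simp
  next
    fix n m assume n: "n \<in> ?K" and m: "m \<in> ?K"
    have "m \<in> carrier G" "n \<in> carrier G" using n m by auto
    \<comment> \<open>The swap for \<open>m\<close> commutes with \<open>\<phi> n\<close>, so
      applying it second produces \<open>n \<otimes> m\<close>.\<close>
    moreover have "orbit_swap x (\<phi> m x) (\<phi> n x) = \<phi> n (\<phi> m x)"
      using m n x orbit_swap_left[of x "\<phi> m x" n] by simp
    ultimately show "n \<otimes> m \<in> ?K"
      using key[of "n \<otimes> m" "compose E (orbit_swap x (\<phi> m x)) (orbit_swap x (\<phi> n x))"]
        x K(1)[OF n] K(1)[OF m] K(2)[OF n] K(3)[OF n] K(3)[OF m] compose_closed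
      by (simp add: compose_eq)
  next
    fix n assume n: "n \<in> ?K"
    then have nc: "n \<in> carrier G" by blast
    obtain h where h: "h \<in> \<Gamma>" "\<And>z. z \<in> E \<Longrightarrow> h (orbit_swap x (\<phi> n x) z) = z"
      using inverse_exists[OF K(1)[OF n]] by metis
    have "h \<in> automorphisms" using h sub by blast
    then have "\<phi> n (h x) = x" using h(2)[OF x] K(2)[OF n] x nc by simp
    then have "h x = \<phi> (inv n) x"
      using nc x \<open>h \<in> automorphisms\<close> act_inv_cancel(1)[OF nc, of "h x"] by simp
    moreover have "h z = z" if "z \<in> E" "z \<notin> orbit G \<phi> x" for z
      using h(2)[OF that(1)] K(3)[OF n that] by simp
    ultimately show "inv n \<in> ?K" using key[of "inv n" h] nc h(1) by simp
  qed
qed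

end

section \<open>From a few swaps to all swaps with a given stabilizer\<close>

context automorphism_submonoid
begin

text \<open>As the orbits are different, conjugating the swap by itself interchanges its two
  arguments.\<close>

lemma orbit_swap_sym_closed:
  assumes xy: "x \<in> E" "y \<in> E" "stabilizer G \<phi> x = stabilizer G \<phi> y" "y \<notin> orbit G \<phi> x"
    and "orbit_swap x y \<in> \<Gamma>"
  shows "orbit_swap y x \<in> \<Gamma>"
  using conj_orbit_swap_closed[OF assms(5,5) xy(1-3)]
  by (simp add: orbit_swap_left1[OF xy(1-3)] orbit_swap_right1[OF xy])

text \<open>Conjugate the swap of \<open>x\<close> and \<open>y\<close> by that of \<open>y\<close>
  and \<open>z\<close>, which fixes \<open>x\<close>. The orbits of \<open>y\<close> and
  \<open>z\<close> may coincide, but \<open>x\<close> must lie in neither.\<close>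

lemma orbit_swap_trans_closed:
  assumes x: "x \<in> E" and y: "y \<in> E" "stabilizer G \<phi> x = stabilizer G \<phi> y" "y \<notin> orbit G \<phi> x"
    and z: "z \<in> E" "stabilizer G \<phi> y = stabilizer G \<phi> z" "z \<notin> orbit G \<phi> x"
    and "orbit_swap x y \<in> \<Gamma>" "orbit_swap y z \<in> \<Gamma>"
  shows "orbit_swap x z \<in> \<Gamma>"
proof -
  have "x \<notin> orbit G \<phi> y" "x \<notin> orbit G \<phi> z"
    using in_orbit_sym[OF x y(1)] in_orbit_sym[OF x z(1)] y z by simp_all
  then have "orbit_swap y z x = x" using x by (simp add: orbit_swap_other)
  then show ?thesis
    using conj_orbit_swap_closed[OF assms(9,8) x y(1,2)] orbit_swap_left1[OF y(1) z(1,2)] by simp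
qed

text \<open>Adjacent swaps link all representatives, and conjugation carries the swaps of
  \<open>y 0\<close> inside its orbit to the other orbits. Moving representatives inside their
  orbits then reaches every pair.\<close>

lemma orbit_swap_closed_if_transversal:
  assumes tr: "transversal H k y"
    and adj: "\<And>i. Suc i < k \<Longrightarrow> orbit_swap (y i) (y (Suc i)) \<in> \<Gamma>"
    and loc: "\<And>n. \<lbrakk>0 < k; n \<in> carrier G; n <# H #> inv n = H\<rbrakk> \<Longrightarrow>
      orbit_swap (y 0) (\<phi> n (y 0)) \<in> \<Gamma>"
    and x: "x \<in> E" "stabilizer G \<phi> x = H" and z: "z \<in> E" "stabilizer G \<phi> z = H"
  shows "orbit_swap x z \<in> \<Gamma>"
proof -
  note y = transversalD[OF tr]
  have first: "orbit_swap (y 0) (y i) \<in> \<Gamma>" if "0 < i" "i < k" for i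
    using that
  proof (induction i)
    case (Suc i)
    show ?case
    proof (cases "i = 0")
      case True
      then show ?thesis using adj Suc.prems by simp
    next
      case False
      then show ?thesis
        using orbit_swap_trans_closed[of "y 0" "y i" "y (Suc i)"] adj[of i] Suc y by simp
    qed
  qed simp
  have loc': "orbit_swap (y i) (\<phi> n (y i)) \<in> \<Gamma>"
    if "i < k" "n \<in> carrier G" "n <# H #> inv n = H" for i n
  proof (cases "i = 0")
    case False
    then have st: "y 0 \<in> E" "y i \<in> E" "stabilizer G \<phi> (y 0) = stabilizer G \<phi> (y i)"
      using y that by simp_all
    have "orbit_swap (y 0) (\<phi> n (y 0)) \<in> \<Gamma>" using loc that by simp
    moreover have "stabilizer G \<phi> (y 0) = stabilizer G \<phi> (\<phi> n (y 0))"
      using that st y by (simp add: stabilizer_act)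
    ultimately show ?thesis
      using conj_orbit_swap_closed[OF first[of i], of "y 0" "\<phi> n (y 0)"] False that st
        orbit_swap_left[OF st, of n] orbit_swap_left1[OF st] by simp
  qed (use loc that in simp)
  \<comment> \<open>Shifting by \<open>inv a\<close> turns the pair into \<open>y i\<close> and
    \<open>\<phi> n (y i)\<close>. Equal stabilizers force \<open>n\<close> to normalize
    \<open>H\<close>.\<close>
  have same: "orbit_swap u v \<in> \<Gamma>"
    if uv: "u \<in> E" "stabilizer G \<phi> u = H" "v \<in> E" "stabilizer G \<phi> v = H"
      "i < k" "u \<in> orbit G \<phi> (y i)" "v \<in> orbit G \<phi> (y i)" for u v i
  proof -
    obtain a b where ab: "a \<in> carrier G" "u = \<phi> a (y i)" "b \<in> carrier G" "v = \<phi> b (y i)"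
      using uv(6,7) unfolding in_orbit_iff by blast
    define n where "n = inv a \<otimes> b"
    have n: "n \<in> carrier G" using ab by (simp add: n_def)
    have v: "v = \<phi> a (\<phi> n (y i))" using ab that y by (simp add: n_def)
    then have nv: "\<phi> n (y i) = \<phi> (inv a) v" and yu: "y i = \<phi> (inv a) u"
      using ab n that y by simp_all
    have "stabilizer G \<phi> (\<phi> (inv a) v) = stabilizer G \<phi> (\<phi> (inv a) u)"
      using ab(1) uv(1-4) by (simp only: stabilizer_act inv_closed)
    then have "stabilizer G \<phi> (\<phi> n (y i)) = stabilizer G \<phi> (y i)"
      by (simp only: nv yu[symmetric])
    then have nH: "stabilizer G \<phi> (\<phi> n (y i)) = H" using y that by simp
    then have "n <# H #> inv n = H" using stabilizer_act[OF n, of "y i"] y that by simp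
    then have "orbit_swap (y i) (\<phi> n (y i)) \<in> \<Gamma>" using loc' n that by simp
    then show ?thesis
      using orbit_swap_shift[of "y i" "\<phi> n (y i)" a] nH n ab y that v by simp
  qed
  have distinct: "orbit_swap (y i) (y j) \<in> \<Gamma>" if "i < k" "j < k" "i \<noteq> j" for i j
  proof (cases "j = 0 \<or> i = 0")
    case True
    then show ?thesis
      using first[of i] first[of j] orbit_swap_sym_closed[of "y 0" "y i"] that y by auto
  next
    case False
    then have "orbit_swap (y i) (y 0) \<in> \<Gamma>"
      using first[of i] orbit_swap_sym_closed[of "y 0" "y i"] that y by auto
    then show ?thesis
      using orbit_swap_trans_closed[of "y i" "y 0" "y j"] first[of j] False that y by simp
  qed
  obtain i where i: "i < k" "x \<in> orbit G \<phi> (y i)"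
    using tr x by (auto simp: transversal_def)
  obtain j where j: "j < k" "z \<in> orbit G \<phi> (y j)"
    using tr z by (auto simp: transversal_def)
  show ?thesis
  proof (cases "i = j")
    case True
    then show ?thesis using same[OF x z] i j by simp
  next
    case False
    \<comment> \<open>Go from \<open>y i\<close> via \<open>y j\<close> to \<open>z\<close>,
      reverse, continue from \<open>z\<close> via \<open>y i\<close> to \<open>x\<close>, and
      reverse again. In this order transitivity never returns to the orbit it started from.\<close>
    obtain a b where ab: "a \<in> carrier G" "x = \<phi> a (y i)" "b \<in> carrier G" "z = \<phi> b (y j)"
      using i(2) j(2) unfolding in_orbit_iff by blast
    have orb: "orbit G \<phi> x = orbit G \<phi> (y i)" "orbit G \<phi> z = orbit G \<phi> (y j)"
      using ab i j y by simp_all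
    have nin: "y i \<notin> orbit G \<phi> (y j)" "y j \<notin> orbit G \<phi> (y i)"
      "z \<notin> orbit G \<phi> (y i)" "x \<notin> orbit G \<phi> (y j)"
      using y False i j ab by simp_all
    have "orbit_swap (y j) z \<in> \<Gamma>" "orbit_swap (y i) x \<in> \<Gamma>"
      using same[of "y j" z j] same[of "y i" x i] i j x z y orbit_refl by simp_all
    moreover have "orbit_swap (y i) z \<in> \<Gamma>"
      using orbit_swap_trans_closed[of "y i" "y j" z] calculation distinct[OF i(1) j(1) False]
        nin i j y z by simp
    then have "orbit_swap z (y i) \<in> \<Gamma>"
      using orbit_swap_sym_closed[of "y i" z] nin i y z by simp
    ultimately have "orbit_swap z x \<in> \<Gamma>"
      using orbit_swap_trans_closed[of z "y i" x] nin i j y x z orb by simp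
    then show ?thesis
      using orbit_swap_sym_closed[of z x] x z orb nin by simp
  qed
qed

text \<open>The elements whose swap is available form a subgroup. It contains \<open>H\<close>
  because elements of the stabilizer give the identity, so \<open>D\<close> has to generate the
  normalizer only modulo \<open>H\<close>.\<close>

lemma orbit_swap_closed_if_generated:
  assumes x: "x \<in> E" "stabilizer G \<phi> x = H"
    and D: "D \<subseteq> {n \<in> carrier G. n <# H #> inv n = H}"
    and gen: "\<And>K. subgroup K G \<Longrightarrow> H \<union> D \<subseteq> K \<Longrightarrow> {n \<in> carrier G. n <# H #> inv n = H} \<subseteq> K"
    and mem: "\<And>n. n \<in> D \<Longrightarrow> orbit_swap x (\<phi> n x) \<in> \<Gamma>"
    and n: "n \<in> carrier G" "n <# H #> inv n = H"
  shows "orbit_swap x (\<phi> n x) \<in> \<Gamma>"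
proof -
  let ?K = "{n \<in> carrier G. stabilizer G \<phi> (\<phi> n x) = stabilizer G \<phi> x \<and>
    orbit_swap x (\<phi> n x) \<in> \<Gamma>}"
  have "orbit_swap x x \<in> \<Gamma>"
    using automorphism_eq_orbit_swap[OF id_in_automorphisms x(1)] id_closed orbit_refl x by simp
  then have "H \<subseteq> ?K" unfolding x(2)[symmetric] by (auto simp: stabilizer_def)
  moreover have "D \<subseteq> ?K" using D mem x by (auto simp: stabilizer_act)
  ultimately have "n \<in> ?K" using gen[OF subgroup_orbit_swap[OF x(1)]] n by blast
  then show ?thesis by blast
qed

end

section \<open>Generators for the points with one fixed stabilizer\<close>

context finite_action
begin

text \<open>The last conclusion ranges over every \<open>\<Gamma>\<close> containing
  \<open>T\<close>, so that the sets found for different classes can later be united.\<close>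

lemma stabilizer_generators_exist:
  assumes D: "finite D" "D \<subseteq> {n \<in> carrier G. n <# H #> inv n = H}"
    and gen: "\<And>K. subgroup K G \<Longrightarrow> H \<union> D \<subseteq> K \<Longrightarrow> {n \<in> carrier G. n <# H #> inv n = H} \<subseteq> K"
    and k: "k = card (orbit G \<phi> ` {x \<in> E. stabilizer G \<phi> x = H})"
  obtains T where "T \<subseteq> automorphisms" "finite T"
    "card T \<le> (if k \<le> 1 then card D else if k = 2 \<and> D = {} then 1 else max (card D) 1 + 1)"
    "\<And>\<Gamma> x z. \<lbrakk>automorphism_submonoid G E \<phi> \<Gamma>; T \<subseteq> \<Gamma>; x \<in> E; stabilizer G \<phi> x = H;
       z \<in> E; stabilizer G \<phi> z = H\<rbrakk> \<Longrightarrow> orbit_swap x z \<in> \<Gamma>"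
proof -
  obtain y where tr: "transversal H k y" using transversal_exists[of H] k by blast
  note y = transversalD[OF tr]
  define \<tau> where "\<tau> n = orbit_swap (y 0) (\<phi> n (y 0))" for n
  have \<tau>_aut: "\<tau> n \<in> automorphisms" if "0 < k" "n \<in> D" for n
    unfolding \<tau>_def using that y D
    by (intro orbit_swap_in_automorphisms) (auto simp: stabilizer_act)
  have adj_aut: "orbit_swap (y i) (y (Suc i)) \<in> automorphisms" if "Suc i < k" for i
    using that y by (intro orbit_swap_in_automorphisms) auto
  have reduce: "orbit_swap x z \<in> \<Gamma>"
    if "automorphism_submonoid G E \<phi> \<Gamma>" "\<And>i. Suc i < k \<Longrightarrow> orbit_swap (y i) (y (Suc i)) \<in> \<Gamma>"
      "\<And>n. 0 < k \<Longrightarrow> n \<in> D \<Longrightarrow> \<tau> n \<in> \<Gamma>"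
      "x \<in> E" "stabilizer G \<phi> x = H" "z \<in> E" "stabilizer G \<phi> z = H" for \<Gamma> x z
  proof -
    interpret S: automorphism_submonoid G E \<phi> \<Gamma> by fact
    have "orbit_swap (y 0) (\<phi> n (y 0)) \<in> \<Gamma>"
      if "0 < k" "n \<in> carrier G" "n <# H #> inv n = H" for n
      using S.orbit_swap_closed_if_generated[OF _ _ D(2) gen, of "y 0" n] that y
        \<open>\<And>n. 0 < k \<Longrightarrow> n \<in> D \<Longrightarrow> \<tau> n \<in> \<Gamma>\<close> by (simp add: \<tau>_def)
    then show ?thesis
      using S.orbit_swap_closed_if_transversal[OF tr that(2)] that by blast
  qed
  consider "k \<le> 1" | "k = 2" "D = {}" | "2 \<le> k" "\<not> (k = 2 \<and> D = {})" by linarith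
  then show thesis
  proof cases
    case 1
    \<comment> \<open>For \<open>k = 0\<close> the value \<open>y 0\<close> is unconstrained, so the
      maps \<open>\<tau> n\<close> have to be left out.\<close>
    let ?T = "if k = 0 then {} else \<tau> ` D"
    show thesis
    proof (rule that[of ?T])
      show "card ?T \<le> (if k \<le> 1 then card D else if k = 2 \<and> D = {} then 1 else max (card D) 1 + 1)"
        using 1 D card_image_le[of D \<tau>] by simp
      show "orbit_swap x z \<in> \<Gamma>"
        if "automorphism_submonoid G E \<phi> \<Gamma>" "?T \<subseteq> \<Gamma>"
          "x \<in> E" "stabilizer G \<phi> x = H" "z \<in> E" "stabilizer G \<phi> z = H" for \<Gamma> x z
      proof (rule reduce[OF that(1) _ _ that(3-6)])
        show "\<tau> n \<in> \<Gamma>" if "0 < k" "n \<in> D" for n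
          using that \<open>?T \<subseteq> \<Gamma>\<close> by auto
      qed (use 1 in simp)
    qed (use \<tau>_aut D in auto)
  next
    case 2
    let ?T = "{orbit_swap (y 0) (y 1)}"
    show thesis
    proof (rule that[of ?T])
      show "card ?T \<le> (if k \<le> 1 then card D else if k = 2 \<and> D = {} then 1 else max (card D) 1 + 1)"
        using 2 by simp
      show "orbit_swap x z \<in> \<Gamma>"
        if "automorphism_submonoid G E \<phi> \<Gamma>" "?T \<subseteq> \<Gamma>"
          "x \<in> E" "stabilizer G \<phi> x = H" "z \<in> E" "stabilizer G \<phi> z = H" for \<Gamma> x z
      proof (rule reduce[OF that(1) _ _ that(3-6)])
        show "orbit_swap (y i) (y (Suc i)) \<in> \<Gamma>" if "Suc i < k" for i
          using that 2 \<open>?T \<subseteq> \<Gamma>\<close> by (cases i) simp_all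
      qed (use 2 in simp)
    qed (use adj_aut[of 0] 2 in auto)
  next
    case 3
    define m where "m = k - 1"
    have m: "Suc m = k" "0 < m" "m < k" using 3 by (auto simp: m_def)
    \<comment> \<open>The element of \<open>D\<close> that the cycle absorbs. For empty
      \<open>D\<close> the default \<open>\<one>\<close> makes the twist \<open>?t\<close> the
      identity.\<close>
    define n where "n = (if D = {} then \<one> else (SOME n. n \<in> D))"
    have nD: "n \<in> D" if "D \<noteq> {}" using that some_in_eq[of D] by (simp add: n_def)
    have n: "n \<in> carrier G" using nD D by (cases "D = {}") (auto simp: n_def)
    have stab_n: "stabilizer G \<phi> (\<phi> n (y i)) = H" if "i < k" for i
      using nD D that y n by (cases "D = {}") (auto simp: n_def stabilizer_act)
    let ?t = "orbit_swap (y m) (\<phi> n (y m))"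
    \<comment> \<open>The twist acts first, so \<open>y m\<close> goes to
      \<open>\<phi> n (y m)\<close>, which the plain cycle takes to
      \<open>\<phi> n (y 0)\<close>.\<close>
    let ?w = "compose E (orbit_cycle y m) ?t"
    let ?T = "insert (orbit_swap (y 0) (y 1)) (insert ?w (\<tau> ` (D - {n})))"
    have t_aut: "?t \<in> automorphisms"
      using y m n stab_n by (intro orbit_swap_in_automorphisms) auto
    have w_aut: "?w \<in> automorphisms"
      using t_aut orbit_cycle_in_automorphisms[OF tr m(3)] by (rule compose_in_automorphisms[rotated])
    have w_apply: "?w (y i) = y (Suc i)" if "i < m" for i
    proof -
      have i: "i < k" "i \<noteq> m" using that m by simp_all
      then have "y i \<notin> orbit G \<phi> (y m)" using y m by simp
      then have "?t (y i) = y i" using i m n y by (simp add: orbit_swap_other)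
      then show ?thesis using orbit_cycle_apply[OF tr m(3) i(1)] that y i by (simp add: compose_eq)
    qed
    show thesis
    proof (rule that[of ?T])
      \<comment> \<open>Removing \<open>n\<close> from a nonempty \<open>D\<close> pays for the
        twisted cycle; for empty \<open>D\<close> just two maps remain.\<close>
      have "card ?T \<le> Suc (Suc (card (\<tau> ` (D - {n}))))"
        using D by (simp add: card_insert_if)
      also have "\<dots> \<le> Suc (Suc (card (D - {n})))"
        using D card_image_le[of "D - {n}" \<tau>] by simp
      also have "\<dots> \<le> max (card D) 1 + 1"
        using D nD card_Diff_singleton[of n D] card_gt_0_iff[of D] by (cases "D = {}") auto
      finally show "card ?T \<le> (if k \<le> 1 then card D else if k = 2 \<and> D = {} then 1
          else max (card D) 1 + 1)"
        using 3 by auto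
      show "?T \<subseteq> automorphisms" using adj_aut[of 0] \<tau>_aut w_aut m by auto
      fix \<Gamma> x z
      assume \<Gamma>: "automorphism_submonoid G E \<phi> \<Gamma>" and T: "?T \<subseteq> \<Gamma>"
        and xz: "x \<in> E" "stabilizer G \<phi> x = H" "z \<in> E" "stabilizer G \<phi> z = H"
      interpret S: automorphism_submonoid G E \<phi> \<Gamma> by fact
      \<comment> \<open>Conjugation by \<open>?w\<close> advances an adjacent swap by one place; it
        is evaluated only at indices below \<open>m\<close>, where the twist is invisible.\<close>
      have adj: "orbit_swap (y i) (y (Suc i)) \<in> \<Gamma>" if "Suc i < k" for i
        using that
      proof (induction i)
        case (Suc i)
        then show ?case
          using S.conj_orbit_swap_closed[of ?w "y i" "y (Suc i)"] T w_apply[of i] w_apply[of "Suc i"]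
            y m by simp
      qed (use T in simp)
      have c: "orbit_cycle y j \<in> \<Gamma>" if "j < k" for j
        using that
      proof (induction j)
        case (Suc j)
        then show ?case using S.compose_closed adj by simp
      qed (simp add: S.id_closed)
      \<comment> \<open>Cancelling the plain cycle from \<open>?w\<close> leaves the twist at
        \<open>y m\<close>; conjugation by the cycle moves it to \<open>y 0\<close>, giving
        \<open>\<tau> n\<close>.\<close>
      obtain h where h: "h \<in> \<Gamma>" "\<And>x. x \<in> E \<Longrightarrow> h (orbit_cycle y m x) = x"
        using S.inverse_exists[OF c[OF m(3)]] by metis
      have t_eq: "?t = compose E h ?w"
      proof (rule extensionalityI[of _ E])
        fix u assume "u \<in> E"
        then show "?t u = compose E h ?w u" using h(2)[of "?t u"] t_aut by (simp add: compose_eq)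
      qed (auto simp: orbit_swap_def compose_def)
      have "compose E h ?w \<in> \<Gamma>" using S.compose_closed[OF h(1)] T by simp
      then have "?t \<in> \<Gamma>" by (rule ssubst[OF t_eq])
      moreover have "orbit_cycle y m (y m) = y 0" using orbit_cycle_apply[OF tr m(3) m(3)] by simp
      moreover have "orbit_cycle y m (\<phi> n (y m)) = \<phi> n (y 0)"
        using calculation orbit_cycle_in_automorphisms[OF tr m(3)] n y m by simp
      ultimately have "\<tau> n \<in> \<Gamma>"
        using S.conj_orbit_swap_closed[OF c[OF m(3)], of "y m" "\<phi> n (y m)"] n y m stab_n
        by (simp add: \<tau>_def)
      then have "\<tau> n' \<in> \<Gamma>" if "n' \<in> D" for n'
        using that T by (cases "n' = n") auto
      then show "orbit_swap x z \<in> \<Gamma>" using reduce[OF \<Gamma> adj _ xz] by blast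
    qed (use D in auto)
  qed
qed

end

section \<open>Generators of normalizers\<close>

context group
begin

text \<open>Like \<open>is_subgroup_chain\<close>, but with a free top \<open>K\<close>, so that
  chains can be extended step by step.\<close>

definition chain_to :: "nat \<Rightarrow> 'a set \<Rightarrow> bool" where
  "chain_to l K \<longleftrightarrow> (\<exists>f. f 0 = {\<one>} \<and> f l = K \<and> (\<forall>i\<le>l. subgroup (f i) G) \<and> (\<forall>i<l. f i \<subset> f (Suc i)))"

lemma chain_to_Suc:
  assumes "chain_to l K" "subgroup L G" "K \<subset> L"
  shows "chain_to (Suc l) L"
proof -
  obtain f where f: "f 0 = {\<one>}" "f l = K" "\<forall>i\<le>l. subgroup (f i) G" "\<forall>i<l. f i \<subset> f (Suc i)"
    using assms(1) by (auto simp: chain_to_def)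
  have "(f(Suc l := L)) i \<subset> (f(Suc l := L)) (Suc i)" if "i < Suc l" for i
    using that f assms(3) by (cases "i = l") auto
  moreover have "subgroup ((f(Suc l := L)) i) G" if "i \<le> Suc l" for i
    using that f assms(2) by (cases "i = Suc l") auto
  ultimately show ?thesis
    using f(1) unfolding chain_to_def by (intro exI[of _ "f(Suc l := L)"]) simp
qed

lemma chain_to_exists:
  assumes "subgroup H G"
  obtains l where "chain_to l H"
proof -
  have triv: "chain_to 0 {\<one>}"
    unfolding chain_to_def by (intro exI[of _ "\<lambda>_. {\<one>}"]) (simp add: triv_subgroup)
  show thesis
  proof (cases "H = {\<one>}")
    case True
    then show ?thesis using triv that by blast
  next
    case False
    then have "{\<one>} \<subset> H" using subgroup.one_closed[OF assms] by blast
    then show ?thesis using chain_to_Suc[OF triv assms] that by blast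
  qed
qed

text \<open>Cardinalities grow strictly along a chain, so lengths are bounded and
  \<open>GREATEST\<close> is meaningful. A chain stopping at a proper subgroup gains one more step
  to the whole group.\<close>

lemma chain_to_le_subgroup_length:
  assumes fin: "finite (carrier G)" and "chain_to l N"
  shows "l \<le> subgroup_length G"
proof -
  have bound: "m \<le> card (carrier G)" if "is_subgroup_chain G m f" for m f
  proof -
    have "i \<le> card (f i)" if "i \<le> m" for i
      using that
    proof (induction i)
      case (Suc i)
      have "subgroup (f (Suc i)) G"
        using \<open>is_subgroup_chain G m f\<close> Suc.prems by (simp add: is_subgroup_chain_def)
      then have "finite (f (Suc i))"
        using subgroup.subset fin finite_subset by blast
      then have "card (f i) < card (f (Suc i))"
        using \<open>is_subgroup_chain G m f\<close> Suc.prems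
        by (intro psubset_card_mono) (simp_all add: is_subgroup_chain_def)
      then show ?case using Suc by simp
    qed simp
    then have "m \<le> card (f m)" by simp
    moreover have "f m = carrier G" using that by (simp add: is_subgroup_chain_def)
    ultimately show ?thesis by simp
  qed
  have le: "m \<le> subgroup_length G" if "chain_to m (carrier G)" for m
    unfolding subgroup_length_def
  proof (rule Greatest_le_nat)
    show "\<exists>f. is_subgroup_chain G m f"
      using that by (auto simp: chain_to_def is_subgroup_chain_def)
    show "\<And>m. \<exists>f. is_subgroup_chain G m f \<Longrightarrow> m \<le> card (carrier G)" using bound by blast
  qed
  have N: "subgroup N G" using assms(2) by (auto simp: chain_to_def)
  show ?thesis
  proof (cases "N = carrier G")
    case True
    then show ?thesis using le assms(2) by simp
  next
    case False
    then have "N \<subset> carrier G" using subgroup.subset[OF N] by blast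
    then have "Suc l \<le> subgroup_length G"
      using le chain_to_Suc[OF assms(2) subgroup_self] by blast
    then show ?thesis by simp
  qed
qed

text \<open>Adjoin elements outside the current subgroup one at a time. Each one lengthens the
  chain, so the chain to \<open>N\<close> has at least \<open>card D\<close> steps beyond the
  \<open>m\<close> steps to \<open>H\<close>.\<close>

lemma generators_over_subgroup:
  assumes fin: "finite (carrier G)" and N: "subgroup N G"
    and "subgroup H G" "H \<subseteq> N" "chain_to m H"
  shows "\<exists>D l. finite D \<and> D \<subseteq> N \<and> m + card D \<le> l \<and> chain_to l N \<and>
    (\<forall>K. subgroup K G \<longrightarrow> H \<union> D \<subseteq> K \<longrightarrow> N \<subseteq> K)"
  using assms(3-5)
proof (induction "card N - card H" arbitrary: H m rule: less_induct)
  case less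
  show ?case
  proof (cases "H = N")
    case True
    then show ?thesis using less.prems by (intro exI[of _ "{}"] exI[of _ m]) auto
  next
    case False
    then obtain n where n: "n \<in> N" "n \<notin> H" using less.prems by blast
    define L where "L = generate G (insert n H)"
    have sub: "insert n H \<subseteq> carrier G"
      using n less.prems subgroup.subset[OF N] by blast
    have L: "subgroup L G" "insert n H \<subseteq> L" "L \<subseteq> N"
      unfolding L_def using generate_is_subgroup[OF sub] generate.incl[of _ "insert n H" G]
        generate_subgroup_incl[OF _ N, of "insert n H"] n less.prems by auto
    have "H \<subset> L" using L n by blast
    moreover have finN: "finite N" using subgroup.subset[OF N] fin finite_subset by blast
    ultimately have "card H < card L" "card L \<le> card N"
      using L(3) by (auto intro: psubset_card_mono card_mono finite_subset)
    then have "card N - card L < card N - card H" by simp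
    moreover have "chain_to (Suc m) L" using chain_to_Suc less.prems L \<open>H \<subset> L\<close> by blast
    ultimately obtain D l where D: "finite D" "D \<subseteq> N" "Suc m + card D \<le> l" "chain_to l N"
      "\<And>K. subgroup K G \<Longrightarrow> L \<union> D \<subseteq> K \<Longrightarrow> N \<subseteq> K"
      using less.hyps[of L "Suc m"] L by blast
    have "N \<subseteq> K" if K: "subgroup K G" "H \<union> insert n D \<subseteq> K" for K
    proof -
      have "L \<subseteq> K" unfolding L_def using K by (intro generate_subgroup_incl) auto
      then show ?thesis using D(5) K by blast
    qed
    moreover have "m + card (insert n D) \<le> l" using D
      by (simp add: card_insert_if)
    ultimately show ?thesis using D n by (intro exI[of _ "insert n D"] exI[of _ l]) auto
  qed
qed

section \<open>Normalizers and subgroups of prime index\<close>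

lemma conjugation_stabilizer_subgroup:
  assumes "subgroup H G"
  shows "subgroup {n \<in> carrier G. n <# H #> inv n = H} G"
  using normalizer_imp_subgroup[OF subgroup.subset[OF assms]] subgroup.subset[OF assms]
  by (simp add: normalizer_def stabilizer_def)

lemma subgroup_conj_self:
  assumes "subgroup H G" "h \<in> H"
  shows "h <# H #> inv h = H"
  using assms subgroup.mem_carrier[OF assms] subgroup.m_inv_closed[OF assms]
  by (simp add: coset_join3 coset_join2)

lemma normalizer_generators:
  assumes fin: "finite (carrier G)" and H: "subgroup H G"
  obtains D where "finite D" "D \<subseteq> {n \<in> carrier G. n <# H #> inv n = H}"
    "card D \<le> subgroup_length G"
    "\<And>K. subgroup K G \<Longrightarrow> H \<union> D \<subseteq> K \<Longrightarrow> {n \<in> carrier G. n <# H #> inv n = H} \<subseteq> K"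
proof -
  obtain m where m: "chain_to m H" using chain_to_exists[OF H] .
  have "H \<subseteq> {n \<in> carrier G. n <# H #> inv n = H}"
    using subgroup_conj_self[OF H] subgroup.mem_carrier[OF H] by blast
  then obtain D l where D: "finite D" "D \<subseteq> {n \<in> carrier G. n <# H #> inv n = H}"
    "m + card D \<le> l" "chain_to l {n \<in> carrier G. n <# H #> inv n = H}"
    "\<And>K. subgroup K G \<Longrightarrow> H \<union> D \<subseteq> K \<Longrightarrow> {n \<in> carrier G. n <# H #> inv n = H} \<subseteq> K"
    using generators_over_subgroup[OF fin conjugation_stabilizer_subgroup[OF H] H _ m] by blast
  have "card D \<le> subgroup_length G"
    using chain_to_le_subgroup_length[OF fin D(4)] D(3) by simp
  then show thesis using that D by blast
qed

text \<open>By Lagrange the index of \<open>H\<close> is \<open>b * a\<close>, with \<open>b\<close>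
  the index of \<open>K\<close> and \<open>a\<close> that of \<open>H\<close> in \<open>K\<close>.
  As \<open>a\<close> is not 1, primality gives \<open>b = 1\<close>.\<close>

lemma prime_index_maximal:
  assumes fin: "finite (carrier G)" and H: "subgroup H G" and "prime (card (rcosets H))"
    and K: "subgroup K G" "H \<subset> K"
  shows "K = carrier G"
proof -
  have finK: "finite K" using subgroup.subset[OF K(1)] fin finite_subset by blast
  have "subgroup H (G\<lparr>carrier := K\<rparr>)" using subgroup_incl[OF H K(1)] K(2) by blast
  then obtain a where a: "a * card H = card K"
    using group.lagrange[OF subgroup_imp_group[OF K(1)], of H] by (auto simp: order_def)
  obtain b where b: "b * card K = card (carrier G)"
    using lagrange[OF K(1)] by (auto simp: order_def)
  have p: "card (rcosets H) * card H = card (carrier G)"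
    using lagrange[OF H] by (auto simp: order_def)
  have Hpos: "card H > 0" using subgroup.finite_imp_card_positive[OF H fin] .
  have "card H < card K" using finK K(2) by (rule psubset_card_mono)
  then have "a \<noteq> 1" using a by auto
  have "b * a * card H = card (rcosets H) * card H" using a b p by (simp add: mult.assoc)
  then have ab: "b * a = card (rcosets H)" using Hpos by simp
  then have "a = 1 \<or> b = 1" using prime_product[of b a] assms(3) by auto
  then have "b = 1" using \<open>a \<noteq> 1\<close> by simp
  then have "card K = card (carrier G)" using b by simp
  then show ?thesis using card_subset_eq[OF fin subgroup.subset[OF K(1)]] by simp
qed

text \<open>By maximality, a single normalizing element outside \<open>H\<close> generates the whole
  group together with \<open>H\<close>.\<close>

lemma normalizer_generators_prime_index:
  assumes fin: "finite (carrier G)" and H: "subgroup H G" and "prime (card (rcosets H))"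
  obtains D where "finite D" "D \<subseteq> {n \<in> carrier G. n <# H #> inv n = H}" "card D \<le> 1"
    "\<And>K. subgroup K G \<Longrightarrow> H \<union> D \<subseteq> K \<Longrightarrow> {n \<in> carrier G. n <# H #> inv n = H} \<subseteq> K"
proof (cases "{n \<in> carrier G. n <# H #> inv n = H} \<subseteq> H")
  case True
  then show ?thesis using that[of "{}"] by auto
next
  case False
  then obtain n where n: "n \<in> carrier G" "n <# H #> inv n = H" "n \<notin> H" by blast
  show ?thesis
  proof (rule that[of "{n}"])
    fix K assume "subgroup K G" "H \<union> {n} \<subseteq> K"
    then show "{n \<in> carrier G. n <# H #> inv n = H} \<subseteq> K"
      using prime_index_maximal[OF assms, of K] n by blast
  qed (use n in auto)
qed

text \<open>\<open>inv a\<close> and \<open>inv b\<close> also lie outside \<open>H\<close>, hence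
  in the same right coset, as only one other coset exists.\<close>

lemma index_2_mult_closed:
  assumes H: "subgroup H G" and "card (rcosets H) = 2"
    and a: "a \<in> carrier G" "a \<notin> H" and b: "b \<in> carrier G" "b \<notin> H"
  shows "inv a \<otimes> b \<in> H"
proof -
  have "inv a \<notin> H" "inv b \<notin> H"
    using subgroup.m_inv_closed[OF H, of "inv a"] subgroup.m_inv_closed[OF H, of "inv b"] a b by auto
  then have ne: "H #> inv a \<noteq> H" "H #> inv b \<noteq> H"
    using rcos_self[OF _ H, of "inv a"] rcos_self[OF _ H, of "inv b"] a b by auto
  have "H \<in> rcosets H" "H #> inv a \<in> rcosets H" "H #> inv b \<in> rcosets H"
    using subgroup.subgroup_in_rcosets[OF H group_axioms] rcosetsI[OF subgroup.subset[OF H]] a b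
    by auto
  then have "H #> inv a = H #> inv b" using assms(2) ne unfolding card_2_iff by auto
  then have "inv a \<in> H #> inv b" using rcos_self[OF _ H, of "inv a"] a by simp
  then obtain h where "h \<in> H" "inv a = h \<otimes> inv b" unfolding r_coset_def by blast
  then show ?thesis using subgroup.mem_carrier[OF H] b by (simp add: m_assoc)
qed

end

section \<open>The shift action\<close>

text \<open>The restriction to configurations makes each shift extensional, as membership in
  \<open>Bij\<close> requires.\<close>

definition shift_action :: "('a, 'm) monoid_scheme \<Rightarrow> 'b set \<Rightarrow> 'a \<Rightarrow> ('a \<Rightarrow> 'b) \<Rightarrow> 'a \<Rightarrow> 'b" where
  "shift_action G A g = (\<lambda>x\<in>configs G A. shift_config G g x)"

lemma configs_eqI:
  assumes "x \<in> configs G A" "y \<in> configs G A" "\<And>g. g \<in> carrier G \<Longrightarrow> x g = y g"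
  shows "x = y"
  using assms by (intro PiE_ext) (auto simp: configs_def)

lemma (in group) shift_action_apply:
  assumes "g \<in> carrier G" "x \<in> configs G A"
  shows "shift_action G A g x \<in> configs G A"
    "h \<in> carrier G \<Longrightarrow> shift_action G A g x h = x (inv g \<otimes> h)"
  using assms by (auto simp: shift_action_def shift_config_def configs_def PiE_iff)

lemma (in group) shift_action_mult:
  assumes "g \<in> carrier G" "h \<in> carrier G" "x \<in> configs G A"
  shows "shift_action G A (g \<otimes> h) x = shift_action G A g (shift_action G A h x)"
  using assms by (intro configs_eqI[of _ G A]) (simp_all add: shift_action_apply inv_mult_group m_assoc)

lemma (in group) shift_action_one:
  assumes "x \<in> configs G A"
  shows "shift_action G A \<one> x = x"
  using assms by (intro configs_eqI[of _ G A]) (simp_all add: shift_action_apply)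

text \<open>Over a finite group locality is no restriction: the memory set can be the whole group,
  with \<open>\<tau> x \<one>\<close> as local rule. Equivariance recovers the other values.\<close>

lemma (in group) cellular_automaton_iff:
  assumes "finite (carrier G)"
  shows "cellular_automaton G A \<tau> \<longleftrightarrow> \<tau> \<in> configs G A \<rightarrow>\<^sub>E configs G A \<and>
    (\<forall>g\<in>carrier G. \<forall>x\<in>configs G A. \<tau> (shift_action G A g x) = shift_action G A g (\<tau> x))"
    (is "?L \<longleftrightarrow> ?R")
proof
  assume ?L
  then obtain S \<mu> where \<tau>: "\<tau> \<in> configs G A \<rightarrow>\<^sub>E configs G A"
    and \<mu>: "\<And>x g. x \<in> configs G A \<Longrightarrow> g \<in> carrier G \<Longrightarrow>
      \<tau> x g = \<mu> (restrict (shift_config G (inv g) x) S)"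
    by (auto simp: cellular_automaton_def)
  then have \<mu>': "\<tau> x g = \<mu> (restrict (shift_action G A (inv g) x) S)"
    if "x \<in> configs G A" "g \<in> carrier G" for x g
    using that by (simp add: shift_action_def)
  have "\<tau> (shift_action G A g x) = shift_action G A g (\<tau> x)"
    if gx: "g \<in> carrier G" "x \<in> configs G A" for g x
  proof (rule configs_eqI)
    show cl: "\<tau> (shift_action G A g x) \<in> configs G A" "shift_action G A g (\<tau> x) \<in> configs G A"
      using \<tau> gx by (simp_all add: shift_action_apply PiE_iff)
    fix h assume h: "h \<in> carrier G"
    \<comment> \<open>The local rule sees the same pattern in the shifted configuration at
      \<open>h\<close> as in \<open>x\<close> at \<open>inv g \<otimes> h\<close>.\<close>
    have "shift_action G A (inv h) (shift_action G A g x) = shift_action G A (inv (inv g \<otimes> h)) x"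
      using gx h by (simp add: inv_mult_group shift_action_mult)
    moreover have "\<tau> x \<in> configs G A" using \<tau> gx by (simp add: PiE_iff)
    ultimately show "\<tau> (shift_action G A g x) h = shift_action G A g (\<tau> x) h"
      using \<mu>'[of "shift_action G A g x" h] \<mu>'[of x "inv g \<otimes> h"] gx h cl
      by (simp add: shift_action_apply)
  qed
  then show ?R using \<tau> by blast
next
  assume R: ?R
  have cl: "\<tau> x \<in> configs G A" if "x \<in> configs G A" for x using R that by (auto simp: PiE_iff)
  have "(\<lambda>x. \<tau> x \<one>) \<in> (carrier G \<rightarrow>\<^sub>E A) \<rightarrow> A"
    using cl by (auto simp: configs_def PiE_iff)
  moreover have "\<tau> x g = \<tau> (restrict (shift_config G (inv g) x) (carrier G)) \<one>"
    if "x \<in> configs G A" "g \<in> carrier G" for x g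
  proof -
    have "restrict (shift_config G (inv g) x) (carrier G) = shift_action G A (inv g) x"
      using that by (auto simp: shift_action_def shift_config_def)
    then show ?thesis using R that cl by (simp add: shift_action_apply)
  qed
  ultimately show ?L
    unfolding cellular_automaton_def using assms R
    by (intro conjI exI[of _ "carrier G"] exI[of _ "\<lambda>x. \<tau> x \<one>"]) simp_all
qed

text \<open>A configuration fixed by all shifts is constant, hence determined by its value at
  \<open>\<one>\<close>. This limits the number of orbits for the whole group.\<close>

lemma (in group) card_constant_configs:
  assumes fin: "finite (carrier G)" "finite A"
  shows "card {x \<in> configs G A. stabilizer G (shift_action G A) x = carrier G} \<le> card A"
proof (rule card_inj_on_le[where f = "\<lambda>x. x \<one>"])
  have const: "x g = x \<one>" if "x \<in> configs G A" "stabilizer G (shift_action G A) x = carrier G"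
    "g \<in> carrier G" for x g
  proof -
    have "g \<in> stabilizer G (shift_action G A) x" using that by simp
    then have "shift_action G A g x = x" by (simp add: stabilizer_def)
    then show ?thesis using shift_action_apply(2)[of g x A g] that(1,3) by simp
  qed
  show "inj_on (\<lambda>x. x \<one>) {x \<in> configs G A. stabilizer G (shift_action G A) x = carrier G}"
  proof (rule inj_onI)
    fix x y
    assume x: "x \<in> {x \<in> configs G A. stabilizer G (shift_action G A) x = carrier G}"
      and y: "y \<in> {x \<in> configs G A. stabilizer G (shift_action G A) x = carrier G}"
      and "x \<one> = y \<one>"
    then show "x = y"
      using const[of x _] const[of y _]
      by (intro configs_eqI[of x G A y]) (simp_all only: mem_Collect_eq)
  qed
qed (use fin in \<open>auto simp: configs_def PiE_iff\<close>)

text \<open>A configuration with stabilizer \<open>H\<close> of index 2 takes one value on \<open>H\<close> and another one off \<open>H\<close>.\<close>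

lemma (in group) binary_index_2_same_orbit:
  assumes H: "subgroup H G" "card (rcosets H) = 2" and A: "card A = 2"
    and x: "x \<in> configs G A" "stabilizer G (shift_action G A) x = H"
    and y: "y \<in> configs G A" "stabilizer G (shift_action G A) y = H"
  shows "\<exists>g\<in>carrier G. y = shift_action G A g x"
proof -
  have hc: "h \<in> carrier G" if "h \<in> H" for h using subgroup.mem_carrier[OF H(1) that] .
  have inv_stab: "z (inv h \<otimes> g) = z g"
    if "z \<in> configs G A" "stabilizer G (shift_action G A) z = H" "h \<in> H" "g \<in> carrier G" for z h g
  proof -
    have "h \<in> stabilizer G (shift_action G A) z" using that by simp
    then have "shift_action G A h z = z" by (simp add: stabilizer_def)
    then show ?thesis using shift_action_apply(2)[of h z A g] that hc by simp
  qed
  have on: "z h = z \<one>"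
    if "z \<in> configs G A" "stabilizer G (shift_action G A) z = H" "h \<in> H" for z h
    using inv_stab[OF that, of h] hc[OF that(3)] by simp
  have "H \<noteq> carrier G"
  proof
    assume "H = carrier G"
    then have "c = H" if "c \<in> rcosets H" for c
      using that coset_join2[OF _ H(1)] by (auto simp: RCOSETS_def)
    then show False using H(2) unfolding card_2_iff by (metis insertI1 insertI2)
  qed
  then obtain b where b: "b \<in> carrier G" "b \<notin> H" using subgroup.subset[OF H(1)] by blast
  \<comment> \<open>Invariance under \<open>H\<close> makes \<open>z\<close> constant on right
    cosets. The element \<open>b \<otimes> inv c\<close> lies in \<open>H\<close>, and its inverse
    carries \<open>b\<close> to \<open>c\<close>.\<close>
  have off: "z c = z b"
    if "z \<in> configs G A" "stabilizer G (shift_action G A) z = H" "c \<in> carrier G" "c \<notin> H" for z c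
  proof -
    have ib: "inv b \<in> carrier G" "inv b \<notin> H" "inv c \<in> carrier G" "inv c \<notin> H"
      using b that subgroup.m_inv_closed[OF H(1), of "inv b"]
        subgroup.m_inv_closed[OF H(1), of "inv c"] by auto
    have "b \<otimes> inv c \<in> H" using index_2_mult_closed[OF H ib] b by simp
    moreover have "inv (b \<otimes> inv c) \<otimes> b = c"
      using b that by (simp add: inv_mult_group m_assoc)
    ultimately show ?thesis using inv_stab[OF that(1,2), of "b \<otimes> inv c" b] b by simp
  qed
  \<comment> \<open>If the two values agreed, \<open>z\<close> would be constant and
    \<open>b\<close> would belong to its stabilizer.\<close>
  have neq: "z b \<noteq> z \<one>"
    if z: "z \<in> configs G A" "stabilizer G (shift_action G A) z = H" for z
  proof
    assume "z b = z \<one>"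
    then have const: "z g = z \<one>" if "g \<in> carrier G" for g
      using on[OF z] off[OF z] that by metis
    have "shift_action G A b z = z"
    proof (rule configs_eqI)
      fix g assume g: "g \<in> carrier G"
      then have "inv b \<otimes> g \<in> carrier G" using b by simp
      then show "shift_action G A b z g = z g"
        using const[of g] const[of "inv b \<otimes> g"] z(1) b g by (simp add: shift_action_apply)
    qed (use z b in \<open>simp_all add: shift_action_apply\<close>)
    then show False using b z by (auto simp: stabilizer_def)
  qed
  have val: "x \<one> \<in> A" "x b \<in> A" "y \<one> \<in> A" "y b \<in> A"
    using x y b by (auto simp: configs_def PiE_iff)
  have cases: "y \<one> = x \<one> \<and> y b = x b \<or> y \<one> = x b \<and> y b = x \<one>"
    using A val neq[OF x] neq[OF y] unfolding card_2_iff by auto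
  show ?thesis
  proof (cases "y \<one> = x \<one>")
    case True
    have "y g = x g" if "g \<in> carrier G" for g
      using on[OF x, of g] on[OF y, of g] off[OF x that] off[OF y that] cases True neq[OF x]
      by (cases "g \<in> H") auto
    then have "y = x"
      using x(1) y(1) by (intro configs_eqI[of y G A x])
    then show ?thesis using x(1) by (intro bexI[of _ \<one>]) (simp_all add: shift_action_one)
  next
    case False
    \<comment> \<open>The values are exchanged, and left multiplication by \<open>inv b\<close>
      interchanges \<open>H\<close> with its complement, so shifting by \<open>b\<close>
      works.\<close>
    have "y g = x (inv b \<otimes> g)" if g: "g \<in> carrier G" for g
    proof (cases "g \<in> H")
      case True
      have "inv b \<otimes> g \<notin> H"
      proof
        assume "inv b \<otimes> g \<in> H"
        then have "inv b \<otimes> g \<otimes> inv g \<in> H"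
          using subgroup.m_closed[OF H(1)] subgroup.m_inv_closed[OF H(1) True] by blast
        then have "inv b \<in> H" using b g by (simp add: m_assoc)
        then show False using subgroup.m_inv_closed[OF H(1), of "inv b"] b by simp
      qed
      then have "x (inv b \<otimes> g) = x b" using off[OF x, of "inv b \<otimes> g"] b g by simp
      then show ?thesis using on[OF y True] cases False by simp
    next
      case 2: False
      have "inv b \<otimes> g \<in> H" using index_2_mult_closed[OF H b g 2] .
      then have "x (inv b \<otimes> g) = x \<one>" using on[OF x] by simp
      then show ?thesis using off[OF y g 2] cases False by simp
    qed
    then have "y = shift_action G A b x"
      using y(1) x(1) b by (intro configs_eqI[of y G A]) (simp_all add: shift_action_apply)
    then show ?thesis using b by blast
  qed
qed

section \<open>The automorphisms of the shift action as the unit group of \<open>CA\<close>\<close>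

lemma (in group) finite_shift_action:
  assumes "finite (carrier G)" "finite A"
  shows "finite_action G (configs G A) (shift_action G A)"
proof -
  have bij: "shift_action G A g \<in> Bij (configs G A)" if g: "g \<in> carrier G" for g
  proof -
    have "bij_betw (shift_action G A g) (configs G A) (configs G A)"
      using g by (intro bij_betw_byWitness[where f' = "shift_action G A (inv g)"])
        (auto simp: shift_action_one shift_action_apply(1) shift_action_mult[symmetric])
    then show ?thesis by (simp add: Bij_def shift_action_def)
  qed
  have "shift_action G A (g \<otimes> h) = compose (configs G A) (shift_action G A g) (shift_action G A h)"
    if "g \<in> carrier G" "h \<in> carrier G" for g h
  proof (rule extensionalityI[of _ "configs G A"])
    fix x assume "x \<in> configs G A"
    then show "shift_action G A (g \<otimes> h) x =
        compose (configs G A) (shift_action G A g) (shift_action G A h) x"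
      using that by (simp add: compose_eq shift_action_mult)
  qed (auto simp: shift_action_def compose_def)
  then have "shift_action G A \<in> hom G (BijGroup (configs G A))"
    using bij by (intro homI) (simp_all add: BijGroup_def)
  then show ?thesis
    unfolding finite_action_def group_action_def finite_action_axioms_def
      group_hom_def group_hom_axioms_def
    using assms group_axioms group_BijGroup by (simp add: configs_def finite_PiE)
qed

lemma (in group) carrier_ICA:
  assumes fin: "finite (carrier G)" "finite A"
  shows "carrier (ICA G A) = finite_action.automorphisms G (configs G A) (shift_action G A)"
proof -
  interpret finite_action G "configs G A" "shift_action G A"
    using finite_shift_action[OF fin] .
  let ?X = "configs G A"
  have Bij_PiE: "f \<in> ?X \<rightarrow>\<^sub>E ?X" if "f \<in> Bij ?X" for f
    using Bij_imp_funcset[OF that] Bij_imp_extensional[OF that] by (simp add: PiE_def)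
  have aut: "f \<in> automorphisms \<longleftrightarrow> cellular_automaton G A f \<and> f \<in> Bij ?X" for f
    using Bij_PiE by (auto simp: automorphisms_def cellular_automaton_iff[OF fin(1)])
  \<comment> \<open>For the full set of automorphisms, \<open>inverse_exists\<close> yields an
    inverse that is itself equivariant, hence a cellular automaton.\<close>
  interpret A: automorphism_submonoid G ?X "shift_action G A" automorphisms
    by unfold_locales (simp_all add: id_in_automorphisms compose_in_automorphisms)
  have "f \<in> Units (CA G A) \<longleftrightarrow> f \<in> automorphisms" for f
  proof
    assume "f \<in> Units (CA G A)"
    then obtain h where fh: "cellular_automaton G A f" "cellular_automaton G A h"
      "compose ?X h f = (\<lambda>x\<in>?X. x)" "compose ?X f h = (\<lambda>x\<in>?X. x)"
      by (auto simp: Units_def CA_def)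
    then have "f \<in> ?X \<rightarrow>\<^sub>E ?X" "h \<in> ?X \<rightarrow>\<^sub>E ?X" by (auto simp: cellular_automaton_def)
    moreover have "h (f x) = x" "f (h x) = x" if "x \<in> ?X" for x
      using fun_cong[OF fh(3), of x] fun_cong[OF fh(4), of x] that by (simp_all add: compose_eq)
    ultimately have "bij_betw f ?X ?X"
      by (intro bij_betw_byWitness[where f' = h]) (auto simp: PiE_iff)
    then show "f \<in> automorphisms"
      using fh(1) \<open>f \<in> ?X \<rightarrow>\<^sub>E ?X\<close> by (simp add: aut Bij_def PiE_def)
  next
    assume f: "f \<in> automorphisms"
    obtain h where h: "h \<in> automorphisms" "\<And>x. x \<in> ?X \<Longrightarrow> h (f x) = x"
      "\<And>x. x \<in> ?X \<Longrightarrow> f (h x) = x"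
      using A.inverse_exists[OF f] by metis
    have "compose ?X h f = (\<lambda>x\<in>?X. x)" "compose ?X f h = (\<lambda>x\<in>?X. x)"
      using h by (auto simp: compose_def)
    then show "f \<in> Units (CA G A)"
      using f h(1) aut by (auto simp: Units_def CA_def)
  qed
  then show ?thesis by (auto simp: ICA_def units_of_carrier)
qed

text \<open>The generated submonoid is the intersection of all submonoids containing
  \<open>T\<close>, and each of them is an admissible \<open>\<Gamma>\<close>.\<close>

lemma (in group) monoid_rank_ICA_le:
  assumes fin: "finite (carrier G)" "finite A"
    and T: "finite T" "T \<subseteq> finite_action.automorphisms G (configs G A) (shift_action G A)"
    and gen: "\<And>\<Gamma>. automorphism_submonoid G (configs G A) (shift_action G A) \<Gamma> \<Longrightarrow> T \<subseteq> \<Gamma> \<Longrightarrow>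
      finite_action.automorphisms G (configs G A) (shift_action G A) \<subseteq> \<Gamma>"
  shows "monoid_rank (ICA G A) \<le> card T"
proof -
  interpret finite_action G "configs G A" "shift_action G A"
    using finite_shift_action[OF fin] .
  have ICA: "carrier (ICA G A) = automorphisms" "monoid.mult (ICA G A) = compose (configs G A)"
    "one (ICA G A) = (\<lambda>x\<in>configs G A. x)"
    using carrier_ICA[OF fin] by (simp_all add: ICA_def units_of_mult units_of_one CA_def)
  have sub: "automorphism_submonoid G (configs G A) (shift_action G A) N"
    if "submonoid N (ICA G A)" for N
    using submonoid.subset[OF that] submonoid.m_closed[OF that] submonoid.one_closed[OF that]
    by unfold_locales (simp_all add: ICA)
  have aut: "submonoid automorphisms (ICA G A)"
    by (rule submonoid.intro) (auto simp: ICA id_in_automorphisms compose_in_automorphisms)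
  have "generated_submonoid (ICA G A) T = carrier (ICA G A)"
    unfolding generated_submonoid_def ICA(1)
  proof (rule equalityI)
    show "\<Inter> {N. submonoid N (ICA G A) \<and> T \<subseteq> N} \<subseteq> automorphisms" using aut T by blast
    show "automorphisms \<subseteq> \<Inter> {N. submonoid N (ICA G A) \<and> T \<subseteq> N}" using gen sub by blast
  qed
  then show ?thesis
    unfolding monoid_rank_def using T ICA by (intro Least_le exI[of _ T]) simp
qed

section \<open>Counting generators\<close>

context group
begin

lemma subgroup_classes_nonempty: "C \<in> subgroup_classes G \<Longrightarrow> C \<noteq> {}"
  using group_action.orbit_refl[OF action_by_conjugation_on_subgroups_set]
  by (auto simp: subgroup_classes_def orbits_def)

lemma Union_subgroup_classes: "\<Union> (subgroup_classes G) = {H. subgroup H G}"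
  using group_action.orbits_coverture[OF action_by_conjugation_on_subgroups_set]
  by (simp add: subgroup_classes_def)

lemma finite_subgroup_classes:
  assumes "finite (carrier G)"
  shows "finite (subgroup_classes G)"
proof (rule finite_subset)
  show "subgroup_classes G \<subseteq> Pow (Pow (carrier G))"
    using Union_subgroup_classes subgroup.subset by blast
qed (use assms in simp)

lemma subgroup_classes_conj:
  assumes C: "C \<in> subgroup_classes G" and H: "H \<in> C" and K: "K \<in> C"
  obtains g where "g \<in> carrier G" "K = g <# H #> inv g"
proof -
  let ?\<psi> = "\<lambda>g. \<lambda>H\<in>{H. subgroup H G}. g <# H #> inv g"
  interpret conj: group_action G "{H. subgroup H G}" ?\<psi>
    by (rule action_by_conjugation_on_subgroups_set)
  obtain L where L: "subgroup L G" "C = orbit G ?\<psi> L"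
    using C by (auto simp: subgroup_classes_def orbits_def)
  have sub: "subgroup H G" "subgroup K G" using C H K Union_subgroup_classes by auto
  have "L \<in> orbit G ?\<psi> H" using conj.orbit_sym[of L H] L sub H by blast
  then have "K \<in> orbit G ?\<psi> H" using conj.orbit_trans[of H L K] L sub K by blast
  then show thesis using that sub unfolding orbit_def by auto
qed

text \<open>Combines the bounds on normalizer generators with the number of orbits for
  \<open>H\<close>. Two generators suffice, up to the length as surcharge, which is waived for prime
  index and the whole group; two letters save one more for index 2 and the whole group.\<close>

lemma stabilizer_class_generators:
  assumes fin: "finite (carrier G)" "finite A" and H: "subgroup H G"
  obtains T where "finite T" "T \<subseteq> finite_action.automorphisms G (configs G A) (shift_action G A)"
    "card T \<le> subgroup_length G + 2"
    "prime (card (rcosets H)) \<or> H = carrier G \<Longrightarrow> card T \<le> 2"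
    "card A = 2 \<Longrightarrow> card (rcosets H) = 2 \<or> H = carrier G \<Longrightarrow> card T \<le> 1"
    "\<And>\<Gamma> x z. \<lbrakk>automorphism_submonoid G (configs G A) (shift_action G A) \<Gamma>; T \<subseteq> \<Gamma>;
       x \<in> configs G A; stabilizer G (shift_action G A) x = H;
       z \<in> configs G A; stabilizer G (shift_action G A) z = H\<rbrakk> \<Longrightarrow>
       finite_action.orbit_swap G (configs G A) (shift_action G A) x z \<in> \<Gamma>"
proof -
  interpret F: finite_action G "configs G A" "shift_action G A"
    using finite_shift_action[OF fin] .
  let ?N = "{n \<in> carrier G. n <# H #> inv n = H}"
  obtain D where D: "finite D" "D \<subseteq> ?N"
    "\<And>K. subgroup K G \<Longrightarrow> H \<union> D \<subseteq> K \<Longrightarrow> ?N \<subseteq> K"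
    \<comment> \<open>The alternative \<open>card D \<le> 1\<close> spares prime index a comparison
      with the length. Empty \<open>D\<close> for the whole group opens the case of two orbits and
      one swap.\<close>
    and card_D: "card D \<le> subgroup_length G \<or> card D \<le> 1"
      "prime (card (rcosets H)) \<Longrightarrow> card D \<le> 1" "H = carrier G \<Longrightarrow> D = {}"
  proof -
    consider "H = carrier G" | "H \<noteq> carrier G" "prime (card (rcosets H))"
      | "H \<noteq> carrier G" "\<not> prime (card (rcosets H))" by blast
    then show thesis
    proof cases
      case 1
      show ?thesis by (rule that[of "{}"]) (use 1 in auto)
    next
      case 2
      show ?thesis
      proof (rule normalizer_generators_prime_index[OF fin(1) H 2(2)])
        fix D
        assume D: "finite D" "D \<subseteq> ?N" "card D \<le> 1"
          and gen: "\<And>K. subgroup K G \<Longrightarrow> H \<union> D \<subseteq> K \<Longrightarrow> ?N \<subseteq> K"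
        show thesis by (rule that[OF D(1,2) gen]) (use 2 D in simp_all)
      qed
    next
      case 3
      show ?thesis
      proof (rule normalizer_generators[OF fin(1) H])
        fix D
        assume D: "finite D" "D \<subseteq> ?N" "card D \<le> subgroup_length G"
          and gen: "\<And>K. subgroup K G \<Longrightarrow> H \<union> D \<subseteq> K \<Longrightarrow> ?N \<subseteq> K"
        show thesis by (rule that[OF D(1,2) gen]) (use 3 D in simp_all)
      qed
    qed
  qed
  let ?Y = "{x \<in> configs G A. stabilizer G (shift_action G A) x = H}"
  define k where "k = card (orbit G (shift_action G A) ` ?Y)"
  have finY: "finite ?Y" using F.finite_E by simp
  have k2: "k \<le> 2" if "card A = 2" "H = carrier G"
    using card_image_le[OF finY, of "orbit G (shift_action G A)"] card_constant_configs[OF fin] that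
    by (simp add: k_def)
  have k1: "k \<le> 1" if "card A = 2" "card (rcosets H) = 2"
  proof -
    have "u = v" if uv: "u \<in> orbit G (shift_action G A) ` ?Y" "v \<in> orbit G (shift_action G A) ` ?Y" for u v
    proof -
      obtain x y where xy: "x \<in> ?Y" "u = orbit G (shift_action G A) x"
        "y \<in> ?Y" "v = orbit G (shift_action G A) y"
        using uv by blast
      then obtain g where "g \<in> carrier G" "y = shift_action G A g x"
        using binary_index_2_same_orbit[OF H \<open>card (rcosets H) = 2\<close> \<open>card A = 2\<close>, of x y] by blast
      then show ?thesis using xy F.orbit_act[of g x] by simp
    qed
    then show ?thesis
      using finY unfolding k_def by (simp add: card_le_Suc0_iff_eq)
  qed
  show thesis
  proof (rule F.stabilizer_generators_exist[OF D k_def])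
    fix T
    assume T: "T \<subseteq> F.automorphisms" "finite T"
      "card T \<le> (if k \<le> 1 then card D else if k = 2 \<and> D = {} then 1 else max (card D) 1 + 1)"
      and gen: "\<And>\<Gamma> x z. \<lbrakk>automorphism_submonoid G (configs G A) (shift_action G A) \<Gamma>; T \<subseteq> \<Gamma>;
        x \<in> configs G A; stabilizer G (shift_action G A) x = H;
        z \<in> configs G A; stabilizer G (shift_action G A) z = H\<rbrakk> \<Longrightarrow> F.orbit_swap x z \<in> \<Gamma>"
    show thesis
    proof (rule that[OF T(2,1) _ _ _ gen])
      show "card T \<le> subgroup_length G + 2"
        using T(3) card_D(1) by (auto split: if_splits)
      show "card T \<le> 2" if "prime (card (rcosets H)) \<or> H = carrier G"
      proof -
        have "card D \<le> 1" using that card_D(2,3) by auto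
        then show ?thesis using T(3) by (auto split: if_splits)
      qed
      show "card T \<le> 1" if A: "card A = 2" and "card (rcosets H) = 2 \<or> H = carrier G"
        using that(2)
      proof
        assume 2: "card (rcosets H) = 2"
        then show ?thesis using T(3) k1[OF A 2] card_D(2) by simp
      next
        assume "H = carrier G"
        then have "D = {}" "k \<le> 2" using k2[OF A] card_D(3) by blast+
        then show ?thesis using T(3) by (auto split: if_splits)
      qed
    qed
  qed
qed

end

lemma sum_indicator_card:
  assumes "finite A" "B \<subseteq> A"
  shows "(\<Sum>x\<in>A. if x \<in> B then c else 0) = int (card B) * c"
  using assms by (simp add: sum.If_cases Int_absorb1)

theorem theorem4:
  fixes G :: "('a, 'm) monoid_scheme" and A :: "'b set" and q :: nat
  assumes "group G" and "finite (carrier G)"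
    and "finite A" and "card A = q" and "q \<ge> 2"
  shows "let r = int (num_subgroup_classes G);
             r\<^sub>2 = int (num_subgroup_classes_index G 2);
             r\<^sub>P = (\<Sum>p\<in>prime_factors (card (carrier G)). int (num_subgroup_classes_index G p));
             l = int (subgroup_length G)
         in int (monoid_rank (ICA G A)) \<le>
              (if q = 2 then (r - r\<^sub>P - 1) * l + 2 * r - r\<^sub>2 - 1
               else (r - r\<^sub>P - 1) * l + 2 * r)"
proof -
  interpret group G by fact
  note fin = \<open>finite (carrier G)\<close> \<open>finite A\<close>
  interpret F: finite_action G "configs G A" "shift_action G A"
    using finite_shift_action[OF fin] .
  define \<C> where "\<C> = subgroup_classes G"
  define S where "S i = {C \<in> \<C>. \<forall>H\<in>C. card (rcosets\<^bsub>G\<^esub> H) = i}" for i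
  define P where "P = prime_factors (card (carrier G))"
  define l where "l = int (subgroup_length G)"
  \<comment> \<open>Classes exempt from the length term: the whole group and all prime indices,
    \<open>1 + r\<^sub>P\<close> in total.\<close>
  define special where "special = insert {carrier G} (\<Union>p\<in>P. S p)"
  \<comment> \<open>Classes that save one generator: for two letters the whole group and index 2,
    \<open>1 + r\<^sub>2\<close> in total.\<close>
  define binary where "binary = (if q = 2 then insert {carrier G} (S 2) else {})"
  have fin\<C>: "finite \<C>" using finite_subgroup_classes[OF fin(1)] by (simp add: \<C>_def)
  have S_sub: "S i \<subseteq> \<C>" for i by (auto simp: S_def)
  have finS: "finite (S i)" for i using S_sub fin\<C> by (rule finite_subset)

  have top: "{carrier G} \<in> \<C>"
  proof -
    obtain C where C: "C \<in> \<C>" "carrier G \<in> C"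
      using Union_subgroup_classes subgroup_self unfolding \<C>_def by blast
    have "H = carrier G" if "H \<in> C" for H
      using subgroup_classes_conj[OF C(1)[unfolded \<C>_def] C(2) that]
        subgroup_conj_self[OF subgroup_self] by metis
    then have "C = {carrier G}" using C(2) by blast
    then show ?thesis using C(1) by simp
  qed
  have top_index: "card (rcosets\<^bsub>G\<^esub> (carrier G)) = 1"
    using lagrange[OF subgroup_self] fin(1) one_closed by (auto simp: order_def)
  have top_notin: "{carrier G} \<notin> S i" if "i \<noteq> 1" for i
    using that top_index by (simp add: S_def)
  have P1: "p \<noteq> 1" "prime p" if "p \<in> P" for p
    using that by (auto simp: P_def in_prime_factors_iff)
  have finP: "finite P" by (simp add: P_def)
  \<comment> \<open>An empty class would satisfy the condition for every index; nonemptiness makes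
    the index unique.\<close>
  have disj: "S i \<inter> S j = {}" if "i \<noteq> j" for i j
  proof (rule ccontr)
    assume "S i \<inter> S j \<noteq> {}"
    then obtain C where C: "C \<in> S i" "C \<in> S j" by blast
    then have "C \<noteq> {}" using subgroup_classes_nonempty by (auto simp: S_def \<C>_def)
    then show False using C that by (auto simp: S_def)
  qed
  have card_special: "card special = 1 + (\<Sum>p\<in>P. card (S p))"
  proof -
    have "card (\<Union>p\<in>P. S p) = (\<Sum>p\<in>P. card (S p))"
      using finP finS disj by (intro card_UN_disjoint) auto
    moreover have "{carrier G} \<notin> (\<Union>p\<in>P. S p)" using top_notin P1 by auto
    ultimately show ?thesis using finP finS by (simp add: special_def)
  qed
  have card_binary: "card binary = (if q = 2 then 1 + card (S 2) else 0)"
    using top_notin[of 2] finS by (simp add: binary_def)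
  have special_sub: "special \<subseteq> \<C>" and binary_sub: "binary \<subseteq> \<C>"
    using top S_sub by (auto simp: special_def binary_def)

  define H where "H C = (SOME H. H \<in> C)" for C :: "'a set set"
  have H: "H C \<in> C" if "C \<in> \<C>" for C
    using subgroup_classes_nonempty that some_in_eq unfolding H_def \<C>_def by blast
  have sub_H: "subgroup (H C) G" if "C \<in> \<C>" for C
    using H[OF that] that Union_subgroup_classes unfolding \<C>_def by blast
  \<comment> \<open>Object-level connectives allow one choice function \<open>T\<close> to be
    extracted for all classes.\<close>
  have "\<forall>C\<in>\<C>. \<exists>T. finite T \<and> T \<subseteq> F.automorphisms \<and> card T \<le> subgroup_length G + 2 \<and>
      (prime (card (rcosets\<^bsub>G\<^esub> (H C))) \<or> H C = carrier G \<longrightarrow> card T \<le> 2) \<and>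
      (card A = 2 \<longrightarrow> card (rcosets\<^bsub>G\<^esub> (H C)) = 2 \<or> H C = carrier G \<longrightarrow> card T \<le> 1) \<and>
      (\<forall>\<Gamma> x z. automorphism_submonoid G (configs G A) (shift_action G A) \<Gamma> \<longrightarrow> T \<subseteq> \<Gamma> \<longrightarrow>
        x \<in> configs G A \<longrightarrow> stabilizer G (shift_action G A) x = H C \<longrightarrow>
        z \<in> configs G A \<longrightarrow> stabilizer G (shift_action G A) z = H C \<longrightarrow> F.orbit_swap x z \<in> \<Gamma>)"
    (is "\<forall>C\<in>\<C>. \<exists>T. ?Q C T")
  proof
    fix C assume "C \<in> \<C>"
    show "\<exists>T. ?Q C T"
    proof (rule stabilizer_class_generators[OF fin sub_H[OF \<open>C \<in> \<C>\<close>]])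
      fix T
      assume "finite T" "T \<subseteq> F.automorphisms" "card T \<le> subgroup_length G + 2"
        "prime (card (rcosets\<^bsub>G\<^esub> (H C))) \<or> H C = carrier G \<Longrightarrow> card T \<le> 2"
        "card A = 2 \<Longrightarrow> card (rcosets\<^bsub>G\<^esub> (H C)) = 2 \<or> H C = carrier G \<Longrightarrow> card T \<le> 1"
        "\<And>\<Gamma> x z. \<lbrakk>automorphism_submonoid G (configs G A) (shift_action G A) \<Gamma>; T \<subseteq> \<Gamma>;
          x \<in> configs G A; stabilizer G (shift_action G A) x = H C;
          z \<in> configs G A; stabilizer G (shift_action G A) z = H C\<rbrakk> \<Longrightarrow> F.orbit_swap x z \<in> \<Gamma>"
      then show ?thesis by (intro exI[of _ T] conjI impI allI) assumption+
    qed
  qed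
  then obtain T where T: "\<And>C. C \<in> \<C> \<Longrightarrow> ?Q C (T C)" by metis

  \<comment> \<open>With the savings written as indicators, the sum over all classes depends only on
    the sizes of \<open>\<C>\<close>, \<open>special\<close> and \<open>binary\<close>.\<close>
  have bound: "int (card (T C)) \<le>
      2 + (l - (if C \<in> special then l else 0)) - (if C \<in> binary then 1 else 0)" if C: "C \<in> \<C>" for C
  proof -
    have 1: "card (T C) \<le> 2" if "C \<in> special"
    proof -
      have "prime (card (rcosets\<^bsub>G\<^esub> (H C))) \<or> H C = carrier G"
        using that H[OF C] P1 by (auto simp: special_def S_def)
      then show ?thesis using T[OF C] by blast
    qed
    have 2: "card (T C) \<le> 1" if "C \<in> binary"
    proof -
      have "card A = 2" "card (rcosets\<^bsub>G\<^esub> (H C)) = 2 \<or> H C = carrier G"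
        using that H[OF C] assms(4) by (auto simp: binary_def S_def split: if_splits)
      then show ?thesis using T[OF C] by blast
    qed
    have "card (T C) \<le> subgroup_length G + 2" using T[OF C] by blast
    then show ?thesis using 1 2 by (auto simp: l_def)
  qed

  have "monoid_rank (ICA G A) \<le> card (\<Union>C\<in>\<C>. T C)"
  proof (rule monoid_rank_ICA_le[OF fin])
    have "finite (T C)" "T C \<subseteq> F.automorphisms" if "C \<in> \<C>" for C
      using T[OF that] by blast+
    then show "finite (\<Union>C\<in>\<C>. T C)" "(\<Union>C\<in>\<C>. T C) \<subseteq> F.automorphisms"
      using fin\<C> by (simp, blast)
    fix \<Gamma>
    assume \<Gamma>: "automorphism_submonoid G (configs G A) (shift_action G A) \<Gamma>"
      and T\<Gamma>: "(\<Union>C\<in>\<C>. T C) \<subseteq> \<Gamma>"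
    interpret S: automorphism_submonoid G "configs G A" "shift_action G A" \<Gamma> by fact
    show "F.automorphisms \<subseteq> \<Gamma>"
    proof (rule S.automorphisms_subset)
      fix x y
      assume xy: "x \<in> configs G A" "y \<in> configs G A"
        "stabilizer G (shift_action G A) x = stabilizer G (shift_action G A) y"
      \<comment> \<open>The stabilizer of \<open>x\<close> is only conjugate to \<open>H C\<close>.
        Moving \<open>x\<close> and \<open>y\<close> by the same \<open>g\<close> makes both
        stabilizers equal to \<open>H C\<close> and leaves the swap unchanged.\<close>
      obtain C where C: "C \<in> \<C>" "stabilizer G (shift_action G A) x \<in> C"
        using Union_subgroup_classes F.stabilizer_subgroup[OF xy(1)] unfolding \<C>_def by blast
      obtain g where g: "g \<in> carrier G" "H C = g <#\<^bsub>G\<^esub> stabilizer G (shift_action G A) x #>\<^bsub>G\<^esub> inv\<^bsub>G\<^esub> g"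
        using subgroup_classes_conj[OF C(1)[unfolded \<C>_def] C(2) H[OF C(1)]] .
      then have "stabilizer G (shift_action G A) (shift_action G A g x) = H C"
        "stabilizer G (shift_action G A) (shift_action G A g y) = H C"
        using xy by (simp_all add: F.stabilizer_act)
      moreover have "shift_action G A g x \<in> configs G A" "shift_action G A g y \<in> configs G A"
        using g xy by simp_all
      moreover have "T C \<subseteq> \<Gamma>" using T\<Gamma> C(1) by blast
      ultimately have "F.orbit_swap (shift_action G A g x) (shift_action G A g y) \<in> \<Gamma>"
        using T[OF C(1)] \<Gamma> by blast
      then show "F.orbit_swap x y \<in> \<Gamma>" using F.orbit_swap_shift[OF xy g(1)] by simp
    qed
  qed
  also have "card (\<Union>C\<in>\<C>. T C) \<le> (\<Sum>C\<in>\<C>. card (T C))" using fin\<C> by (rule card_UN_le)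
  finally have "int (monoid_rank (ICA G A)) \<le> (\<Sum>C\<in>\<C>. int (card (T C)))"
    by (simp flip: of_nat_sum)
  also have "\<dots> \<le> (\<Sum>C\<in>\<C>. 2 + (l - (if C \<in> special then l else 0)) - (if C \<in> binary then 1 else 0))"
    using bound by (rule sum_mono)
  also have "\<dots> = int (card \<C>) * (2 + l) - int (card special) * l - int (card binary)"
    using sum_indicator_card[OF fin\<C> special_sub, of l] sum_indicator_card[OF fin\<C> binary_sub, of 1]
    by (simp add: sum.distrib sum_subtractf algebra_simps)
  finally show ?thesis
    using card_special card_binary
    by (cases "q = 2") (simp_all add: Let_def num_subgroup_classes_def num_subgroup_classes_index_def
        \<C>_def[symmetric] S_def[symmetric] P_def[symmetric] l_def[symmetric] algebra_simps)
qed

end
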